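(* Let $n \ge 1$ and $\nu\ge 1$ be integers. There exists $C > 0$ such that for every $u \in W^{n/(n+1),\,n+1}(\mathbb{S}^n;\mathbb{R}^\nu)$, every $\rho > 0$ and every $a \in \mathbb{H}^{n+1}$, $$\frac{1}{\rho}\int_0^\rho \bigl\|\operatorname{dist}(\mathfrak{H}u, u(\mathbb{S}^n))\bigr\|_{L^\infty(\partial \mathbb{B}^{\mathbb{H}^{n+1}}_r(a))}\,\mathrm{d}r \le \frac{C}{1+\rho^{\frac{1}{n+1}}}\Bigl(\int_{\mathbb{S}^n}\int_{\mathbb{S}^n}\frac{|u(y)-u(z)|^{n+1}}{|y-z|^{2n}}\,\mathrm{d}y\,\mathrm{d}z\Bigr)^{\frac{1}{n+1}}.$$
   Context: $\mathbb{B}^{n+1}$ is the open Euclidean unit ball of $\mathbb{R}^{n+1}$ and $\mathbb{S}^n$ its boundary with surface measure; $|\mathbb{S}^n|$ is the total surface measure. $W^{n/(n+1),n+1}(\mathbb{S}^n;\mathbb{R}^\nu)$ is the set of $u\in L^{n+1}(\mathbb{S}^n;\mathbb{R}^\nu)$ for which the double integral on the right-hand side is finite; $u$ is considered as an everywhere defined measurable map (a fixed representative), so that $u(\mathbb{S}^n)$ is its image. $\mathbb{H}^{n+1}$ is the hyperbolic space in the Poincaré ball model: the set $\mathbb{B}^{n+1}$ with the metric $g(x)[v,w] = \frac{4\, v\cdot w}{(1-|x|^2)^2}$, whose distance is $d_{\mathbb{H}^{n+1}}(x,y) = \operatorname{acosh}\bigl(1+2\frac{|x-y|^2}{(1-|x|^2)(1-|y|^2)}\bigr)$.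 $\mathbb{B}^{\mathbb{H}^{n+1}}_r(a)$ is the hyperbolic ball of center $a$ and radius $r$, and $\partial \mathbb{B}^{\mathbb{H}^{n+1}}_r(a)$ is the hyperbolic sphere. The hyperharmonic extension $\mathfrak{H}u : \mathbb{B}^{n+1}\to\mathbb{R}^\nu$ of $u \in L^1(\mathbb{S}^n;\mathbb{R}^\nu)$ is $$\mathfrak{H}u(x) = \frac{(1-|x|^2)^n}{|\mathbb{S}^n|}\int_{\mathbb{S}^n}\frac{u(y)}{|y-x|^{2n}}\,\mathrm{d}y .$$ $\operatorname{dist}(\mathfrak{H}u,u(\mathbb{S}^n))$ denotes the function $x\mapsto \operatorname{dist}(\mathfrak{H}u(x),u(\mathbb{S}^n)) = \inf_{z\in\mathbb{S}^n}|\mathfrak{H}u(x)-u(z)|$. *)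

theory Defs
  imports "HOL-Analysis.Analysis" "HOL-Probability.Essential_Supremum"
begin

section \<open>Surface measure on Euclidean spheres\<close>

text \<open>
  The surface measure in its polar-coordinate form:
  \<open>\<sigma>(A) = (d / R) \<cdot> \<lambda>({c + t (x - c) | x \<in> A, 0 < t < 1})\<close>, where \<open>d\<close> is the dimension of the
  ambient space. The factor is the usual normalization: the whole sphere gets \<open>d\<close> times the
  volume of the unit ball times \<open>R ^ (d - 1)\<close>, see \<open>emeasure_sphere_measure\<close> below. The measure is
  completed, so measurability on the sphere means measurability in Lebesgue's sense.
\<close>

definition sphere_measure :: "'a::euclidean_space \<Rightarrow> real \<Rightarrow> 'a measure" where
  "sphere_measure c R = completion (scale_measure (ennreal (real DIM('a) / R))
     (distr (restrict_space lborel (ball c R - {c})) (restrict_space borel (sphere c R))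
        (\<lambda>x. c + (R / norm (x - c)) *\<^sub>R (x - c))))"

abbreviation unit_sphere_measure :: "'a::euclidean_space measure" where
  "unit_sphere_measure \<equiv> sphere_measure 0 1"

lemma space_sphere_measure: "space (sphere_measure c R) = sphere c R"
  by (simp add: sphere_measure_def space_scale_measure space_restrict_space)

lemma emeasure_sphere_measure:
  fixes c :: "'a::euclidean_space"
  assumes "R > 0"
  shows "emeasure (sphere_measure c R) (sphere c R)
           = ennreal (real DIM('a) * unit_ball_vol (real DIM('a)) * R ^ (DIM('a) - 1))"
proof -
  let ?p = "\<lambda>x::'a. c + (R / norm (x - c)) *\<^sub>R (x - c)"
  let ?M = "restrict_space lborel (ball c R - {c})"
  let ?N = "restrict_space borel (sphere c R)"
  have p: "?p x \<in> sphere c R" if "x \<noteq> c" for x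
    using that assms by (simp add: dist_norm)
  have meas: "?p \<in> ?M \<rightarrow>\<^sub>M ?N"
    by (rule measurable_restrict_space2, use p in \<open>auto simp: space_restrict_space\<close>)
       (rule measurable_restrict_space1, measurable)
  have top: "sphere c R \<in> sets ?N"
    by (auto simp: sets_restrict_space)
  have pre: "?p -` sphere c R \<inter> space ?M = ball c R - {c}"
    using p by (auto simp: space_restrict_space)
  have "emeasure (distr ?M ?N ?p) (sphere c R) = emeasure ?M (ball c R - {c})"
    using emeasure_distr[OF meas top] by (simp only: pre)
  also have "\<dots> = emeasure lborel (ball c R - {c})"
    by (subst emeasure_restrict_space) auto
  also have "\<dots> = emeasure lborel (ball c R)"
    by (rule emeasure_Diff_null_set) auto
  also have "\<dots> = ennreal (unit_ball_vol (real DIM('a)) * R ^ DIM('a))"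
    using assms by (simp add: emeasure_ball)
  finally have *: "emeasure (distr ?M ?N ?p) (sphere c R)
      = ennreal (unit_ball_vol (real DIM('a)) * R ^ DIM('a))" .
  have pw: "R ^ DIM('a) = R * R ^ (DIM('a) - 1)"
    by (metis DIM_positive power_eq_if less_numeral_extra(3))
  have "emeasure (sphere_measure c R) (sphere c R)
      = emeasure (scale_measure (ennreal (real DIM('a) / R)) (distr ?M ?N ?p)) (sphere c R)"
    unfolding sphere_measure_def using top by (simp add: sets_completionI_sets)
  also have "\<dots> = ennreal (real DIM('a) / R) * ennreal (unit_ball_vol (real DIM('a)) * R ^ DIM('a))"
    by (simp add: *)
  also have "\<dots> = ennreal (real DIM('a) / R * (unit_ball_vol (real DIM('a)) * R ^ DIM('a)))"
    using assms by (intro ennreal_mult[symmetric]) auto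
  also have "real DIM('a) / R * (unit_ball_vol (real DIM('a)) * R ^ DIM('a))
      = real DIM('a) * unit_ball_vol (real DIM('a)) * R ^ (DIM('a) - 1)"
    using assms by (simp add: pw)
  finally show ?thesis .
qed


section \<open>The Poincare ball model\<close>

definition hyp_dist :: "'a::euclidean_space \<Rightarrow> 'a \<Rightarrow> real" where
  "hyp_dist x y = arcosh (1 + 2 * (norm (x - y))\<^sup>2 / ((1 - (norm x)\<^sup>2) * (1 - (norm y)\<^sup>2)))"

definition hyp_sphere :: "'a::euclidean_space \<Rightarrow> real \<Rightarrow> 'a set" where
  "hyp_sphere a r = {x \<in> ball 0 1. hyp_dist a x = r}"

text \<open>A hyperbolic sphere is a Euclidean sphere, with the following center and radius.\<close>

definition hyp_sphere_center :: "'a::euclidean_space \<Rightarrow> real \<Rightarrow> 'a" where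
  "hyp_sphere_center a r = (2 / (2 + (1 - (norm a)\<^sup>2) * (cosh r - 1))) *\<^sub>R a"

definition hyp_sphere_radius :: "'a::euclidean_space \<Rightarrow> real \<Rightarrow> real" where
  "hyp_sphere_radius a r = (1 - (norm a)\<^sup>2) * sinh r / (2 + (1 - (norm a)\<^sup>2) * (cosh r - 1))"

lemma hyp_sphere_eq_sphere:
  fixes a :: "'a::euclidean_space"
  assumes a: "a \<in> ball 0 1" and r: "r > 0"
  shows "hyp_sphere a r = sphere (hyp_sphere_center a r) (hyp_sphere_radius a r)"
proof -
  define A where "A = 1 - (norm a)\<^sup>2"
  define k where "k = cosh r - 1"
  define D where "D = 2 + A * k"
  have A: "A > 0"
    using a by (simp add: A_def power_less_one_iff abs_square_less_1)
  have k: "k > 0"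
    using r cosh_real_strict_mono[of 0 r] by (simp add: k_def)
  have D: "D > 0"
    using A k by (simp add: D_def add_pos_pos)
  have sinh2: "(sinh r)\<^sup>2 = k * (k + 2)"
    using cosh_square_eq[of r] by (simp add: k_def power2_eq_square algebra_simps)
  have s: "sinh r > 0"
    using r by simp
  have c: "hyp_sphere_center a r = (2 / D) *\<^sub>R a"
    by (simp add: hyp_sphere_center_def D_def A_def k_def)
  have R: "hyp_sphere_radius a r = A * sinh r / D"
    by (simp add: hyp_sphere_radius_def D_def A_def k_def)
  have Rpos: "hyp_sphere_radius a r > 0"
    using A s D by (simp add: R)
  have key: "x \<in> sphere (hyp_sphere_center a r) (hyp_sphere_radius a r)
      \<longleftrightarrow> 2 * (norm (a - x))\<^sup>2 = k * A * (1 - (norm x)\<^sup>2)" for x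
  proof -
    let ?X = "(norm x)\<^sup>2" and ?i = "a \<bullet> x"
    have na: "(norm a)\<^sup>2 = 1 - A" by (simp add: A_def)
    have e1: "(norm (a - x))\<^sup>2 = 1 - A - 2 * ?i + ?X"
      using na by (simp add: power2_norm_eq_inner algebra_simps inner_commute)
    have "x \<in> sphere (hyp_sphere_center a r) (hyp_sphere_radius a r)
        \<longleftrightarrow> (norm ((2 / D) *\<^sub>R a - x))\<^sup>2 = (A * sinh r / D)\<^sup>2"
      using Rpos by (simp add: c R dist_norm)
    also have "(norm ((2 / D) *\<^sub>R a - x))\<^sup>2 = (2 / D)\<^sup>2 * (1 - A) - 2 * (2 / D) * ?i + ?X"
      unfolding na[symmetric] power2_norm_eq_inner
      by (simp add: algebra_simps inner_commute power2_eq_square)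
    also have "(A * sinh r / D)\<^sup>2 = A\<^sup>2 * (k * (k + 2)) / D\<^sup>2"
      by (simp add: power_mult_distrib power_divide sinh2)
    also have "(2 / D)\<^sup>2 * (1 - A) - 2 * (2 / D) * ?i + ?X = A\<^sup>2 * (k * (k + 2)) / D\<^sup>2
        \<longleftrightarrow> 4 * (1 - A) - 4 * D * ?i + D\<^sup>2 * ?X = A\<^sup>2 * (k * (k + 2))"
    proof -
      have "(2 / D)\<^sup>2 * (1 - A) - 2 * (2 / D) * ?i + ?X
          = (4 * (1 - A) - 4 * D * ?i + D\<^sup>2 * ?X) / D\<^sup>2"
        using D by (simp add: add_divide_distrib diff_divide_distrib power_divide power2_eq_square)
      then show ?thesis using D by simp
    qed
    also have "\<dots> \<longleftrightarrow> D * (2 * (1 - A - 2 * ?i + ?X)) = D * (k * A * (1 - ?X))"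
      unfolding D_def by (auto simp: algebra_simps power2_eq_square)
    also have "\<dots> \<longleftrightarrow> 2 * (norm (a - x))\<^sup>2 = k * A * (1 - (norm x)\<^sup>2)"
      using D by (simp only: e1) simp
    finally show ?thesis .
  qed
  show ?thesis
  proof (intro set_eqI iffI)
    fix x assume "x \<in> hyp_sphere a r"
    then have x: "norm x < 1" and d: "hyp_dist a x = r"
      by (auto simp: hyp_sphere_def)
    have X: "1 - (norm x)\<^sup>2 > 0"
      using x by (simp add: abs_square_less_1)
    have "cosh (hyp_dist a x) = 1 + 2 * (norm (a - x))\<^sup>2 / (A * (1 - (norm x)\<^sup>2))"
      unfolding hyp_dist_def A_def[symmetric] using A X by (intro cosh_arcosh_real) simp
    then have "k = 2 * (norm (a - x))\<^sup>2 / (A * (1 - (norm x)\<^sup>2))"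
      using d by (simp add: k_def)
    then have "2 * (norm (a - x))\<^sup>2 = k * A * (1 - (norm x)\<^sup>2)"
      using A X nonzero_eq_divide_eq[of "A * (1 - (norm x)\<^sup>2)" k "2 * (norm (a - x))\<^sup>2"]
      by (simp add: mult.assoc)
    then show "x \<in> sphere (hyp_sphere_center a r) (hyp_sphere_radius a r)"
      using key by blast
  next
    fix x assume "x \<in> sphere (hyp_sphere_center a r) (hyp_sphere_radius a r)"
    then have eq: "2 * (norm (a - x))\<^sup>2 = k * A * (1 - (norm x)\<^sup>2)"
      using key by blast
    have x: "norm x < 1"
    proof (rule ccontr)
      assume "\<not> norm x < 1"
      then have "(norm x)\<^sup>2 \<ge> 1" by simp
      then have "k * A * (1 - (norm x)\<^sup>2) \<le> 0"
        using A k by (simp add: mult_nonneg_nonpos)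
      then have "(norm (a - x))\<^sup>2 \<le> 0" using eq by linarith
      then have "x = a" by simp
      then show False using \<open>\<not> norm x < 1\<close> a by simp
    qed
    have X: "1 - (norm x)\<^sup>2 > 0"
      using x by (simp add: abs_square_less_1)
    have "2 * (norm (a - x))\<^sup>2 / (A * (1 - (norm x)\<^sup>2)) = k"
      using A X by (simp add: eq)
    then have "hyp_dist a x = arcosh (cosh r)"
      unfolding hyp_dist_def A_def[symmetric] by (simp add: k_def)
    then show "x \<in> hyp_sphere a r"
      using x r by (simp add: hyp_sphere_def arcosh_cosh_real)
  qed
qed

text \<open>
  The metric is \<open>(2 / (1 - |x|\<^sup>2))\<^sup>2\<close> times the Euclidean one, so on a hypersurface the induced
  measure is \<open>(2 / (1 - |x|\<^sup>2)) ^ (d - 1)\<close> times the Euclidean surface measure, where \<open>d\<close> is the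
  dimension of the ball.
\<close>

definition hyp_sphere_measure :: "'a::euclidean_space \<Rightarrow> real \<Rightarrow> 'a measure" where
  "hyp_sphere_measure a r =
     density (sphere_measure (hyp_sphere_center a r) (hyp_sphere_radius a r))
       (\<lambda>x. ennreal ((2 / (1 - (norm x)\<^sup>2)) ^ (DIM('a) - 1)))"

lemma space_hyp_sphere_measure:
  "a \<in> ball 0 1 \<Longrightarrow> r > 0 \<Longrightarrow> space (hyp_sphere_measure a r) = hyp_sphere a r"
  by (simp add: hyp_sphere_measure_def space_sphere_measure hyp_sphere_eq_sphere)


section \<open>Sobolev maps on the sphere and their hyperharmonic extension\<close>

text \<open>
  The unit sphere of \<open>'a\<close> plays the role of the \<open>n\<close>-sphere, with \<open>DIM('a) = n + 1\<close>. Maps on it are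
  functions on \<open>'a\<close> of which only the values on the sphere matter.
\<close>

text \<open>The integrand vanishes on the diagonal, as \<open>0 / 0 = 0\<close>.\<close>

definition gagliardo_energy :: "nat \<Rightarrow> ('a::euclidean_space \<Rightarrow> 'b::euclidean_space) \<Rightarrow> ennreal" where
  "gagliardo_energy n u =
     (\<integral>\<^sup>+ z. (\<integral>\<^sup>+ y. ennreal (norm (u y - u z) ^ (n + 1) / norm (y - z) ^ (2 * n))
        \<partial>unit_sphere_measure) \<partial>unit_sphere_measure)"

definition sobolev_sphere :: "nat \<Rightarrow> ('a::euclidean_space \<Rightarrow> 'b::euclidean_space) set" where
  "sobolev_sphere n = {u. u \<in> borel_measurable unit_sphere_measure
     \<and> (\<integral>\<^sup>+ y. ennreal (norm (u y) ^ (n + 1)) \<partial>unit_sphere_measure) < \<infinity>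
     \<and> gagliardo_energy n u < \<infinity>}"

definition hyperharmonic_ext ::
    "nat \<Rightarrow> ('a::euclidean_space \<Rightarrow> 'b::euclidean_space) \<Rightarrow> 'a \<Rightarrow> 'b" where
  "hyperharmonic_ext n u x =
     ((1 - (norm x)\<^sup>2) ^ n / measure unit_sphere_measure (sphere 0 1 :: 'a set)) *\<^sub>R
       (\<integral> y. (1 / norm (y - x) ^ (2 * n)) *\<^sub>R u y \<partial>unit_sphere_measure)"

definition Linfty_hyp_sphere :: "'a::euclidean_space \<Rightarrow> real \<Rightarrow> ('a \<Rightarrow> real) \<Rightarrow> ennreal" where
  "Linfty_hyp_sphere a r f = esssup (hyp_sphere_measure a r) (\<lambda>x. ennreal \<bar>f x\<bar>)"

end

theory Submission
  imports Defs "HOL-Real_Asymp.Real_Asymp"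
begin

text \<open>
  Write \<open>d\<close> for the hyperbolic distance, \<open>S\<close> for the unit sphere, \<open>n\<close> for its dimension and
  \<open>E\<close> for the Gagliardo energy of \<open>u\<close>. The Poisson kernel \<open>((1 - |x|\<^sup>2) / |y - x|\<^sup>2) ^ n\<close>
  has mean one on \<open>S\<close> (\<open>poisson_nn_integral\<close>): it is the Jacobian, along the sphere, of a
  ball automorphism obtained by normalizing a Lorentz boost of the light cone. So the
  extension of \<open>u\<close> at \<open>x\<close> is a weighted mean of \<open>u\<close>, and its distance to \<open>u(S)\<close> is at most
  the mean of \<open>|u(z) - u(y)|\<close> with \<open>z\<close> distributed by the Poisson kernel and \<open>y\<close> distributed
  in any way whatsoever.

  Taking the Poisson kernel for \<open>y\<close> as well and applying Jensen's inequality is not enough: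
  the resulting weight on a fixed pair \<open>(z, y)\<close> does not decay when \<open>x\<close> moves along the
  geodesic from \<open>z\<close> to \<open>y\<close>, so that its supremum over a hyperbolic sphere is not integrable
  in the radius. Instead, \<open>y\<close> is uniformly distributed on a cap around \<open>x\<close> of size
  comparable to \<open>1 - |x|\<close>, the Poisson kernel is dominated by a geometric mixture of uniform
  distributions on caps whose sizes are the \<open>2 ^ i (1 - |x|)\<close>
  (\<open>poisson_kernel_le_cap_densities\<close>), and a value on a large cap is compared with one on
  the smallest cap through all the intermediate caps (\<open>poisson_average_le_chain\<close>). Only
  pairs in consecutive caps remain, each weighted by \<open>(1/2) ^ i\<close>. This weight \<open>W\<close> satisfies
  \<open>W(z, y) |z - y| ^ (2 n) \<le> K exp (- d(x, p) / 2)\<close>, where \<open>p\<close> is a point of the ball at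
  height about \<open>|z - y|\<close> above \<open>z\<close> (\<open>chain_weight_le\<close>): the bound is largest at \<open>x = p\<close>,
  where \<open>x\<close> has both the scale and the location of the pair, and it decays when \<open>x\<close> moves
  away from \<open>p\<close> in any direction, towards \<open>z\<close> or \<open>y\<close> included.

  By the hyperbolic triangle inequality \<open>d(x, p) \<ge> |d(a, x) - d(a, p)|\<close>, so that on the
  hyperbolic sphere of radius \<open>r\<close> around \<open>a\<close> the bound \<open>exp (- |r - d(a, p)| / 2)\<close> no longer
  depends on the position of \<open>x\<close>. It takes care of the supremum, is uniform in \<open>a\<close>, and its
  integral over \<open>0 < r < \<rho>\<close> is at most \<open>min \<rho> 4\<close>, which is where the gain for large \<open>\<rho>\<close>
  comes from.

  Hoelder's inequality is replaced by the elementary \<open>b \<le> t ^ (- n) b ^ (n + 1) + t\<close>. With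
  the same \<open>t\<close> everywhere, averaging gives \<open>C (t ^ (- n) min (1, 4 / \<rho>) E + t)\<close>
  (\<open>averaged_Linfty_le\<close>), and the choice \<open>t = (min (1, 4 / \<rho>) E) powr (1 / (n + 1))\<close> gives
  the theorem.
\<close>

section \<open>Integrating an exponential on the line\<close>

lemma nn_integral_exp_decay:
  "(\<integral>\<^sup>+ r. ennreal (exp (- \<bar>r - c\<bar> / 2)) \<partial>lborel) \<le> ennreal (4::real)"
proof -
  have lim: "((\<lambda>x::real. - 2 * exp (- x / 2)) \<longlongrightarrow> 0) at_top"
    by real_asymp
  have half: "(\<integral>\<^sup>+ x. ennreal (exp (- x / 2)) * indicator {0..} x \<partial>lborel) = ennreal (0 - (- 2 * exp (- 0 / 2)) :: real)"
    by (rule nn_integral_FTC_atLeast[OF _ _ _ lim])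
       (auto intro!: derivative_eq_intros)
  have "(\<integral>\<^sup>+ r. ennreal (exp (- \<bar>r - c\<bar> / 2)) \<partial>lborel) = (\<integral>\<^sup>+ r. ennreal (exp (- \<bar>r\<bar> / 2)) \<partial>lborel)"
    by (subst nn_integral_real_affine[of _ 1 c]) auto
  also have "\<dots> \<le> (\<integral>\<^sup>+ r. ennreal (exp (- r / 2)) * indicator {0..} r + ennreal (exp (r / 2)) * indicator {0..} (- r) \<partial>lborel)"
    by (intro nn_integral_mono) (auto simp: indicator_def)
  also have "\<dots> = (\<integral>\<^sup>+ r. ennreal (exp (- r / 2)) * indicator {0..} r \<partial>lborel)
      + (\<integral>\<^sup>+ r. ennreal (exp (r / 2)) * indicator {0..} (- r) \<partial>lborel)"
    by (rule nn_integral_add) measurable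
  also have "(\<integral>\<^sup>+ r. ennreal (exp (r / 2)) * indicator {0..} (- r) \<partial>lborel)
      = (\<integral>\<^sup>+ r. ennreal (exp (- r / 2)) * indicator {0..} r \<partial>lborel)"
    by (subst nn_integral_real_affine[of _ "- 1" 0]) auto
  finally show ?thesis unfolding half by simp
qed

lemma borel_measurable_exp_decay_interval:
  "(\<lambda>r::real. ennreal (exp (- \<bar>r - c\<bar> / 2)) * indicator {0<..<\<rho>} r) \<in> borel_measurable lborel"
  by measurable

lemma nn_integral_exp_decay_interval:
  assumes "\<rho> > 0"
  shows "(\<integral>\<^sup>+ r. ennreal (exp (- \<bar>r - c\<bar> / 2)) * indicator {0<..<\<rho>} r \<partial>lborel) \<le> ennreal (min \<rho> 4)"
proof -
  have "(\<integral>\<^sup>+ r. ennreal (exp (- \<bar>r - c\<bar> / 2)) * indicator {0<..<\<rho>} r \<partial>lborel)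
      \<le> (\<integral>\<^sup>+ r. ennreal (exp (- \<bar>r - c\<bar> / 2)) \<partial>lborel)"
    by (intro nn_integral_mono) (auto simp: indicator_def)
  also have "\<dots> \<le> ennreal 4" by (rule nn_integral_exp_decay)
  finally have 4: "(\<integral>\<^sup>+ r. ennreal (exp (- \<bar>r - c\<bar> / 2)) * indicator {0<..<\<rho>} r \<partial>lborel) \<le> ennreal 4" .
  have "(\<integral>\<^sup>+ r. ennreal (exp (- \<bar>r - c\<bar> / 2)) * indicator {0<..<\<rho>} r \<partial>lborel)
      \<le> (\<integral>\<^sup>+ r. indicator {0<..<\<rho>} r \<partial>lborel)"
    by (intro nn_integral_mono) (auto simp: indicator_def)
  also have "\<dots> = ennreal \<rho>" using assms by simp
  finally show ?thesis using 4 by (auto simp: min_def)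
qed

section \<open>Determinants of rank one perturbations\<close>

text \<open>
  For \<open>e \<noteq> 0\<close> let \<open>E\<close> be the identity with one column replaced by \<open>e\<close>, the column \<open>k\<close> being
  chosen such that \<open>E\<close> is invertible. Conjugation by \<open>E\<close> turns the perturbation into one by
  the \<open>k\<close>-th unit vector, which changes a single row, so that its determinant is a diagonal
  entry.
\<close>

lemma det_rank_one:
  fixes e b :: "real^'n"
  shows "det (matrix (\<lambda>v. v + (b \<bullet> v) *\<^sub>R e)) = 1 + b \<bullet> e"
proof (cases "e = 0")
  case True
  then show ?thesis by (simp add: matrix_id_mat_1[unfolded id_def] eta_contract_eq)
next
  case False
  then obtain k where k: "e $ k \<noteq> 0" by (auto simp: vec_eq_iff)
  define E :: "real^'n^'n" where "E = (\<chi> i j. if j = k then e $ i else mat 1 $ i $ j)"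
  define A :: "real^'n^'n" where "A = (\<chi> i j. mat 1 $ i $ j + e $ i * b $ j)"
  define c where "c = transpose E *v b"
  define F :: "real^'n^'n" where "F = (\<chi> i. if i = k then axis k 1 + c else axis i 1)"
  have detE: "det E = e $ k"
    using cramer_lemma[of k "mat 1" e] unfolding matrix_vector_mul_lid by (simp add: E_def)
  have A: "matrix (\<lambda>v. v + (b \<bullet> v) *\<^sub>R e) = A"
  proof -
    have "axis j (1::real) $ i = mat 1 $ i $ j" for i j :: 'n
      by (simp add: axis_def mat_def)
    then show ?thesis
      by (simp add: matrix_def A_def vec_eq_iff inner_axis)
  qed
  have ck: "c $ k = b \<bullet> e"
    by (simp add: c_def matrix_vector_mult_def transpose_def E_def inner_vec_def mult.commute)
  have F_eq: "F = (\<chi> i. if i = k then sum (\<lambda>i. (axis k 1 + c) $ i *s row i (mat 1)) UNIV else row i (mat 1))"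
  proof -
    have row: "row i (mat 1) = (axis i 1 :: real^'n)" for i :: 'n
      by (auto simp: row_def mat_def axis_def vec_eq_iff)
    have "sum (\<lambda>i. x $ i *s row i (mat 1)) UNIV = x" for x :: "real^'n"
      unfolding row by (rule basis_expansion)
    then show ?thesis by (simp only: F_def row)
  qed
  have "det F = (axis k 1 + c) $ k * det (mat 1 :: real^'n^'n)"
    unfolding F_eq by (rule cramer_lemma_transpose)
  then have detF: "det F = 1 + b \<bullet> e"
    by (simp add: ck)
  have "A ** E = E ** F"
  proof -
    have "(A ** E) $ i $ j = E $ i $ j + e $ i * c $ j" for i j
    proof -
      have "(A ** E) $ i $ j = (\<Sum>l\<in>UNIV. (if l = i then E $ i $ j else 0) + e $ i * (E $ l $ j * b $ l))"
        unfolding matrix_matrix_mult_def A_def by (auto intro!: sum.cong simp: mat_def algebra_simps)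
      also have "\<dots> = E $ i $ j + e $ i * (\<Sum>l\<in>UNIV. E $ l $ j * b $ l)"
        by (simp add: sum.distrib sum_distrib_left)
      finally show ?thesis
        by (simp add: c_def matrix_vector_mult_def transpose_def)
    qed
    moreover have "(E ** F) $ i $ j = E $ i $ j + e $ i * c $ j" for i j
    proof -
      have "(E ** F) $ i $ j = (\<Sum>l\<in>UNIV. (if l = j then E $ i $ j else 0) + (if l = k then E $ i $ k * c $ j else 0))"
        unfolding matrix_matrix_mult_def F_def by (auto intro!: sum.cong simp: axis_def algebra_simps)
      also have "\<dots> = E $ i $ j + E $ i $ k * c $ j"
        by (simp add: sum.distrib)
      finally show ?thesis by (simp add: E_def)
    qed
    ultimately show ?thesis by (simp add: vec_eq_iff)
  qed
  then have "det A * det E = det E * det F" by (metis det_mul)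
  then show ?thesis using k by (simp add: A detE detF)
qed

section \<open>Lorentz boosts\<close>

text \<open>
  The light cone \<open>{(s, y). s = |y|}\<close> is parametrized by \<open>y\<close>. A Lorentz boost is determined
  by the vector \<open>p\<close> such that it moves the time axis to the direction \<open>(boost_cosh p, p)\<close>;
  \<open>boost p\<close> is its action on the spatial part of a point of the light cone, and \<open>norm_boost\<close>
  is the matching formula for the time component.
\<close>

definition boost_cosh :: "'a::euclidean_space \<Rightarrow> real" where
  "boost_cosh p = sqrt (1 + (norm p)\<^sup>2)"

definition boost :: "'a::euclidean_space \<Rightarrow> 'a \<Rightarrow> 'a" where
  "boost p y = y + (norm y + (p \<bullet> y) / (1 + boost_cosh p)) *\<^sub>R p"

text \<open>
  The ratio \<open>|boost p z| / |z|\<close>. It depends on the direction of \<open>z\<close> only, and its \<open>n\<close>-th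
  power will turn out to be the inverse of a Poisson kernel.
\<close>

definition sphere_stretch :: "'a::euclidean_space \<Rightarrow> 'a \<Rightarrow> real" where
  "sphere_stretch p z = boost_cosh p + p \<bullet> z / norm z"

text \<open>
  The boost renormalized so as to preserve the norm: it acts on the directions as a Moebius
  transformation of the sphere.
\<close>

definition ball_boost :: "'a::euclidean_space \<Rightarrow> 'a \<Rightarrow> 'a" where
  "ball_boost p y = sphere_stretch (- p) (boost p y) *\<^sub>R boost p y"

lemma boost_cosh_minus [simp]: "boost_cosh (- p) = boost_cosh p"
  by (simp add: boost_cosh_def)

lemma boost_cosh_square: "(boost_cosh p)\<^sup>2 = 1 + (norm p)\<^sup>2"
  by (simp add: boost_cosh_def)

lemma boost_cosh_ge: "boost_cosh p \<ge> 1" "norm p < boost_cosh p"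
  by (simp_all add: boost_cosh_def real_less_rsqrt)

lemma abs_inner_less_boost_cosh:
  assumes "y \<noteq> 0" shows "\<bar>p \<bullet> y\<bar> < boost_cosh p * norm y"
proof -
  have "\<bar>p \<bullet> y\<bar> \<le> norm p * norm y" by (rule Cauchy_Schwarz_ineq2)
  also have "\<dots> < boost_cosh p * norm y"
    using assms boost_cosh_ge(2)[of p] by (intro mult_strict_right_mono) auto
  finally show ?thesis .
qed

lemma sphere_stretch_pos: "y \<noteq> 0 \<Longrightarrow> sphere_stretch p y > 0"
  using abs_inner_less_boost_cosh[of y p]
  by (simp add: sphere_stretch_def field_simps abs_less_iff)

lemma sphere_stretch_scaleR: "t > 0 \<Longrightarrow> sphere_stretch p (t *\<^sub>R y) = sphere_stretch p y"
  by (simp add: sphere_stretch_def)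

lemma inner_boost:
  "p \<bullet> boost p y = boost_cosh p * (p \<bullet> y) + (norm p)\<^sup>2 * norm y"
proof -
  define c where "c = boost_cosh p"
  have c: "c \<ge> 1" "(norm p)\<^sup>2 = (c - 1) * (1 + c)"
    using boost_cosh_ge(1)[of p] boost_cosh_square[of p]
    by (auto simp: c_def power2_eq_square algebra_simps)
  have "p \<bullet> boost p y = p \<bullet> y + (norm p)\<^sup>2 * norm y + (norm p)\<^sup>2 * ((p \<bullet> y) / (1 + c))"
    by (simp add: boost_def c_def[symmetric] inner_add_right power2_norm_eq_inner algebra_simps)
  also have "(norm p)\<^sup>2 * ((p \<bullet> y) / (1 + c)) = (c - 1) * (p \<bullet> y)"
    using c by simp
  finally show ?thesis by (simp add: c_def algebra_simps)
qed

lemma norm_boost: "norm (boost p y) = boost_cosh p * norm y + p \<bullet> y"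
proof -
  define c where "c = boost_cosh p"
  define s where "s = norm y + (p \<bullet> y) / (1 + c)"
  have c: "c \<ge> 1" "(norm p)\<^sup>2 = (c - 1) * (1 + c)"
    using boost_cosh_ge(1)[of p] boost_cosh_square[of p]
    by (auto simp: c_def power2_eq_square algebra_simps)
  have q: "p \<bullet> y = (s - norm y) * (1 + c)" using c by (simp add: s_def)
  have "boost p y = y + s *\<^sub>R p" by (simp add: boost_def s_def c_def)
  then have "(norm (boost p y))\<^sup>2 = (norm y)\<^sup>2 + 2 * s * (p \<bullet> y) + s\<^sup>2 * (norm p)\<^sup>2"
    unfolding power2_norm_eq_inner
    by (simp add: inner_add_left inner_add_right inner_commute algebra_simps power2_eq_square)
  also have "\<dots> = (c * norm y + p \<bullet> y)\<^sup>2"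
    unfolding q c(2) by (simp add: power2_eq_square algebra_simps)
  finally have "(norm (boost p y))\<^sup>2 = (c * norm y + p \<bullet> y)\<^sup>2" .
  moreover have "c * norm y + p \<bullet> y \<ge> 0"
    using abs_inner_less_boost_cosh[of y p] by (cases "y = 0") (auto simp: c_def)
  ultimately show ?thesis by (simp add: c_def)
qed

text \<open>
  The explicit inverse from which the bijectivity of \<open>ball_boost\<close> is deduced.
\<close>

lemma boost_minus_boost: "boost (- p) (boost p y) = y"
proof -
  define c where "c = boost_cosh p"
  define s where "s = norm y + (p \<bullet> y) / (1 + c)"
  have c: "c \<ge> 1" "(norm p)\<^sup>2 = (c - 1) * (1 + c)"
    using boost_cosh_ge(1)[of p] boost_cosh_square[of p]
    by (auto simp: c_def power2_eq_square algebra_simps)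
  have "norm (boost p y) + ((- p) \<bullet> boost p y) / (1 + c)
      = c * norm y + p \<bullet> y - (c * (p \<bullet> y) + (c - 1) * (1 + c) * norm y) / (1 + c)"
    by (simp add: norm_boost inner_boost c c_def[symmetric] diff_divide_distrib add_divide_distrib)
  also have "\<dots> = s"
    using c by (simp add: s_def field_simps)
  finally have *: "norm (boost p y) + ((- p) \<bullet> boost p y) / (1 + c) = s" .
  have "boost (- p) (boost p y) = boost p y - s *\<^sub>R p"
    unfolding boost_def[of "- p"] boost_cosh_minus c_def[symmetric] * by simp
  then show ?thesis by (simp add: boost_def s_def c_def)
qed

lemma boost_eq_0_iff [simp]: "boost p y = 0 \<longleftrightarrow> y = 0"
proof
  assume "boost p y = 0"
  then have "boost (- p) (boost p y) = 0" by (simp add: boost_def)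
  then show "y = 0" by (simp add: boost_minus_boost)
qed (simp add: boost_def)

lemma sphere_stretch_boost:
  assumes "y \<noteq> 0"
  shows "sphere_stretch (- p) (boost p y) = 1 / sphere_stretch p y"
proof -
  have pos: "boost_cosh p * norm y + p \<bullet> y > 0"
    using abs_inner_less_boost_cosh[OF assms, of p] by linarith
  have "sphere_stretch (- p) (boost p y)
      = boost_cosh p - (boost_cosh p * (p \<bullet> y) + (norm p)\<^sup>2 * norm y) / (boost_cosh p * norm y + p \<bullet> y)"
    by (simp add: sphere_stretch_def norm_boost inner_boost diff_divide_distrib add_divide_distrib)
  also have "\<dots> = ((boost_cosh p)\<^sup>2 - (norm p)\<^sup>2) * norm y / (boost_cosh p * norm y + p \<bullet> y)"
    using pos by (simp add: field_simps power2_eq_square)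
  also have "\<dots> = norm y / (boost_cosh p * norm y + p \<bullet> y)"
    by (simp add: boost_cosh_square)
  also have "\<dots> = 1 / sphere_stretch p y"
    using assms pos by (simp add: sphere_stretch_def field_simps)
  finally show ?thesis .
qed

lemma norm_ball_boost: "norm (ball_boost p y) = norm y"
proof (cases "y = 0")
  case False
  then have "norm (ball_boost p y) = norm (boost p y) / sphere_stretch p y"
    using sphere_stretch_pos[of y p] by (simp add: ball_boost_def sphere_stretch_boost)
  also have "norm (boost p y) = sphere_stretch p y * norm y"
    using False by (simp add: norm_boost sphere_stretch_def field_simps)
  finally show ?thesis using sphere_stretch_pos[OF False, of p] by simp
qed (simp add: ball_boost_def boost_def)

lemma ball_boost_eq_0_iff [simp]: "ball_boost p y = 0 \<longleftrightarrow> y = 0"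
  by (metis norm_ball_boost norm_eq_zero)

text \<open>
  The factor by which a boosted vector is rescaled only depends on its direction, which the
  rescaling preserves. So it can be read off from the result and undone.
\<close>

lemma inj_on_ball_boost: "inj_on (ball_boost p) (- {0})"
proof (rule inj_onI)
  fix y z assume y: "y \<in> - {0}" and z: "z \<in> - {0}" and eq: "ball_boost p y = ball_boost p z"
  have *: "sphere_stretch (- p) (boost p w) > 0"
       "sphere_stretch (- p) (ball_boost p w) = sphere_stretch (- p) (boost p w)" if "w \<noteq> 0" for w
    using sphere_stretch_pos[of "boost p w" "- p"] that
    by (auto simp: ball_boost_def sphere_stretch_scaleR)
  have "sphere_stretch (- p) (boost p y) = sphere_stretch (- p) (boost p z)"
    using *(2)[of y] *(2)[of z] y z eq by simp
  then have "boost p y = boost p z"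
    using eq *(1)[of y] y unfolding ball_boost_def by auto
  then show "y = z" by (metis boost_minus_boost)
qed

lemma ball_boost_image: "ball_boost p ` (ball 0 1 - {0}) = ball 0 1 - {0}"
proof
  show "ball_boost p ` (ball 0 1 - {0}) \<subseteq> ball 0 1 - {0}"
    by (auto simp: norm_ball_boost)
next
  show "ball 0 1 - {0} \<subseteq> ball_boost p ` (ball 0 1 - {0})"
  proof
    fix w :: 'a assume w: "w \<in> ball 0 1 - {0}"
    define k where "k = sphere_stretch (- p) w"
    have k: "k > 0" using w sphere_stretch_pos by (auto simp: k_def)
    define y where "y = boost (- p) ((1 / k) *\<^sub>R w)"
    have "boost p y = (1 / k) *\<^sub>R w"
      using boost_minus_boost[of "- p"] by (simp add: y_def)
    then have w_eq: "ball_boost p y = w"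
      using k sphere_stretch_scaleR[of "1 / k" "- p" w] by (simp add: ball_boost_def k_def)
    then have "norm y = norm w" by (metis norm_ball_boost)
    then have "y \<in> ball 0 1 - {0}" using w by auto
    with w_eq show "w \<in> ball_boost p ` (ball 0 1 - {0})" by blast
  qed
qed

lemma has_derivative_boost:
  assumes "y \<noteq> 0"
  shows "(boost p has_derivative (\<lambda>v. v + ((y /\<^sub>R norm y + p /\<^sub>R (1 + boost_cosh p)) \<bullet> v) *\<^sub>R p)) (at y within S)"
proof -
  have norm: "(norm has_derivative (\<lambda>v. v \<bullet> sgn y)) (at y within S)"
    by (rule has_derivative_at_withinI[OF has_derivative_norm[OF assms]])
  have "((\<lambda>y. y + (norm y + (p /\<^sub>R (1 + boost_cosh p)) \<bullet> y) *\<^sub>R p)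
      has_derivative (\<lambda>v. v + (v \<bullet> sgn y + (p /\<^sub>R (1 + boost_cosh p)) \<bullet> v) *\<^sub>R p)) (at y within S)"
    by (rule has_derivative_add[OF has_derivative_ident has_derivative_scaleR_left[OF
          has_derivative_add[OF norm has_derivative_inner_right[OF has_derivative_ident]]]])
  moreover have "(\<lambda>y. y + (norm y + (p /\<^sub>R (1 + boost_cosh p)) \<bullet> y) *\<^sub>R p) = boost p"
    by (rule ext) (simp add: boost_def divide_inverse mult.commute)
  moreover have "(\<lambda>v. v + (v \<bullet> sgn y + (p /\<^sub>R (1 + boost_cosh p)) \<bullet> v) *\<^sub>R p)
      = (\<lambda>v. v + ((y /\<^sub>R norm y + p /\<^sub>R (1 + boost_cosh p)) \<bullet> v) *\<^sub>R p)"
    by (rule ext) (simp add: inner_add_left inner_add_right sgn_div_norm inner_commute)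
  ultimately show ?thesis by simp
qed

lemma has_derivative_stretch:
  fixes z :: "'a::euclidean_space"
  assumes "z \<noteq> 0"
  shows "((\<lambda>z. sphere_stretch p z *\<^sub>R z) has_derivative
    (\<lambda>v. sphere_stretch p z *\<^sub>R v + ((p /\<^sub>R norm z - ((p \<bullet> z) / norm z ^ 3) *\<^sub>R z) \<bullet> v) *\<^sub>R z)) (at z within S)"
proof -
  have norm: "(norm has_derivative (\<lambda>v. v \<bullet> sgn z)) (at z within S)"
    by (rule has_derivative_at_withinI[OF has_derivative_norm[OF assms]])
  have "((\<lambda>z. p \<bullet> z / norm z) has_derivative
      (\<lambda>v. - (p \<bullet> z) * (inverse (norm z) * (v \<bullet> sgn z) * inverse (norm z)) + p \<bullet> v / norm z)) (at z within S)"
    using assms by (intro has_derivative_divide has_derivative_inner_right has_derivative_ident norm) simp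
  moreover have "(\<lambda>v. - (p \<bullet> z) * (inverse (norm z) * (v \<bullet> sgn z) * inverse (norm z)) + p \<bullet> v / norm z)
     = (\<lambda>v. (p /\<^sub>R norm z - ((p \<bullet> z) / norm z ^ 3) *\<^sub>R z) \<bullet> v)"
    using assms by (simp add: fun_eq_iff inner_diff_left inner_diff_right sgn_div_norm inner_commute power3_eq_cube field_simps)
  ultimately have "((\<lambda>z. p \<bullet> z / norm z) has_derivative
      (\<lambda>v. (p /\<^sub>R norm z - ((p \<bullet> z) / norm z ^ 3) *\<^sub>R z) \<bullet> v)) (at z within S)"
    by simp
  from has_derivative_scaleR[OF has_derivative_add[OF has_derivative_const[of "boost_cosh p"] this] has_derivative_ident]
  show ?thesis
    by (simp add: sphere_stretch_def)
qed

text \<open>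
  The map is a boost followed by the rescaling \<open>z \<mapsto> k(z) z\<close>, where \<open>k\<close> is homogeneous of
  degree zero. Both derivatives are rank one perturbations of multiples of the identity. The
  boost has determinant \<open>sphere_stretch p y\<close>. By Euler's identity the gradient of \<open>k\<close> is
  orthogonal to \<open>z\<close>, so that the rescaling has determinant \<open>k(z) ^ (n + 1)\<close>, and \<open>k\<close> at the
  boosted point is the inverse of the stretching factor.
\<close>

lemma det_has_derivative_ball_boost:
  fixes y :: "real^'n"
  assumes y: "y \<noteq> 0"
  obtains D where "\<And>S. (ball_boost p has_derivative D) (at y within S)"
    "det (matrix D) = 1 / sphere_stretch p y ^ (CARD('n) - 1)"
proof
  define z where "z = boost p y"
  define k where "k = sphere_stretch (- p) z"
  define g where "g = (- p) /\<^sub>R norm z - ((- p \<bullet> z) / norm z ^ 3) *\<^sub>R z"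
  define b where "b = y /\<^sub>R norm y + p /\<^sub>R (1 + boost_cosh p)"
  define A where "A = (\<lambda>v. v + (b \<bullet> v) *\<^sub>R p)"
  define B where "B = (\<lambda>v. k *\<^sub>R v + (g \<bullet> v) *\<^sub>R z)"
  have z: "z \<noteq> 0" using y by (simp add: z_def)
  have k: "k = 1 / sphere_stretch p y" "k > 0"
    using sphere_stretch_pos[OF y] sphere_stretch_boost[OF y] by (auto simp: k_def z_def)
  \<comment> \<open>Euler's identity for \<open>k\<close>, which is homogeneous of degree zero.\<close>
  have gz: "g \<bullet> z = 0"
    using z by (simp add: g_def inner_diff_left power3_eq_cube power2_norm_eq_inner[symmetric] field_simps power2_eq_square)
  show "(ball_boost p has_derivative (B \<circ> A)) (at y within S)" for S
    using diff_chain_within[OF has_derivative_boost[OF y, of p S] has_derivative_stretch[OF z[unfolded z_def], of "- p" "boost p ` S"]]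
    by (simp add: A_def B_def b_def g_def k_def z_def ball_boost_def[abs_def] o_def)
  have lin: "linear A" "linear B" "linear ((*\<^sub>R) k :: real^'n \<Rightarrow> _)" "linear (\<lambda>v. v + ((g /\<^sub>R k) \<bullet> v) *\<^sub>R z)"
    unfolding A_def B_def by (auto intro!: linearI simp: inner_add_right algebra_simps)
  have "B = (\<lambda>v. v + ((g /\<^sub>R k) \<bullet> v) *\<^sub>R z) \<circ> ((*\<^sub>R) k)"
    using k by (auto simp: B_def fun_eq_iff)
  then have "det (matrix B) = (1 + (g /\<^sub>R k) \<bullet> z) * k ^ CARD('n)"
    by (simp only: matrix_compose[OF lin(3,4)] det_mul det_rank_one det_matrix_scaleR)
  then have detB: "det (matrix B) = k ^ CARD('n)" by (simp add: gz)
  have "det (matrix A) = 1 + b \<bullet> p"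
    unfolding A_def by (rule det_rank_one)
  also have "\<dots> = sphere_stretch p y"
  proof -
    have "(norm p)\<^sup>2 / (1 + boost_cosh p) = boost_cosh p - 1"
      using boost_cosh_ge(1)[of p] boost_cosh_square[of p]
      by (simp add: field_simps power2_eq_square)
    then show ?thesis
      by (simp add: b_def sphere_stretch_def inner_add_left inner_commute divide_inverse power2_norm_eq_inner algebra_simps)
  qed
  finally have "det (matrix (B \<circ> A)) = k ^ CARD('n) * sphere_stretch p y"
    by (simp add: matrix_compose[OF lin(1,2)] det_mul detB)
  also have "\<dots> = 1 / sphere_stretch p y ^ (CARD('n) - 1)"
    using sphere_stretch_pos[OF y, of p] power_minus_mult[of "CARD('n)" "sphere_stretch p y"]
    unfolding k(1) power_one_over by (simp add: field_simps)
  finally show "det (matrix (B \<circ> A)) = 1 / sphere_stretch p y ^ (CARD('n) - 1)" .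
qed

text \<open>
  The map \<open>ball_boost p\<close> is a bijection of the punctured ball, and the integrand is its
  Jacobian.
\<close>

lemma stretch_power_has_integral_vec:
  fixes p :: "real^'n::{finite,wellorder}"
  shows "((\<lambda>y. 1 / sphere_stretch p y ^ (CARD('n::{finite,wellorder}) - 1)) has_integral measure lebesgue (ball 0 1 :: (real^'n::{finite,wellorder}) set))
    (ball 0 1 - {0})"
proof -
  let ?S = "ball 0 1 - {0} :: (real^'n::{finite,wellorder}) set"
  have "\<exists>D. (\<forall>S. (ball_boost p has_derivative D) (at y within S)) \<and>
     det (matrix D) = 1 / sphere_stretch p y ^ (CARD('n::{finite,wellorder}) - 1)" if "y \<in> ?S" for y
    using det_has_derivative_ball_boost[of y p] that by (metis DiffD2 singletonI)
  then obtain D where D: "\<And>y S. y \<in> ?S \<Longrightarrow> (ball_boost p has_derivative D y) (at y within S)"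
     "\<And>y. y \<in> ?S \<Longrightarrow> det (matrix (D y)) = 1 / sphere_stretch p y ^ (CARD('n::{finite,wellorder}) - 1)"
    by metis
  have inj: "inj_on (ball_boost p) ?S"
    by (rule inj_on_subset[OF inj_on_ball_boost]) auto
  have "measure lebesgue ?S = measure lebesgue (ball 0 1 :: (real^'n::{finite,wellorder}) set)"
    by (rule measure_negligible_symdiff) (auto intro: negligible_subset[of "{0}"])
  moreover have S: "?S \<in> lmeasurable" by (intro bounded_set_imp_lmeasurable) auto
  ultimately have "((\<lambda>y. \<bar>det (matrix (D y))\<bar>) has_integral measure lebesgue (ball 0 1 :: (real^'n::{finite,wellorder}) set)) ?S"
    using has_measure_differentiable_image[OF fmeasurableD[OF S] D(1) inj] S
    unfolding ball_boost_image by metis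
  moreover have "\<bar>det (matrix (D y))\<bar> = 1 / sphere_stretch p y ^ (CARD('n::{finite,wellorder}) - 1)" if "y \<in> ?S" for y
    using D(2)[OF that] sphere_stretch_pos[of y p] that by (simp add: zero_le_power)
  ultimately show ?thesis
    by (rule has_integral_eq[rotated])
qed

section \<open>Coordinates in an arbitrary Euclidean space\<close>

text \<open>
  The standard basis as a type. With a well-order on it, real tuples indexed by it are
  subject to the change of variables formula, and every Euclidean space is isometric to such
  a space of tuples.
\<close>

typedef (overloaded) 'a axes = "Basis :: 'a::euclidean_space set"
  by (rule nonempty_Basis[unfolded ex_in_conv[symmetric]])

instance axes :: (euclidean_space) finite
proof
  have "(UNIV :: 'a axes set) = Abs_axes ` Basis"
    using type_definition.Abs_image[OF type_definition_axes] by metis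
  then show "finite (UNIV :: 'a axes set)" by (metis finite_Basis finite_imageI)
qed

definition axes_rank :: "'a::euclidean_space axes \<Rightarrow> nat" where
  "axes_rank = (SOME f. inj f)"

lemma inj_axes_rank: "inj (axes_rank :: 'a::euclidean_space axes \<Rightarrow> nat)"
proof -
  have "\<exists>f :: 'a axes \<Rightarrow> nat. inj f"
    using finite_imp_inj_to_nat_seg[OF finite_class.finite_UNIV] by metis
  then show ?thesis
    unfolding axes_rank_def by (rule someI_ex)
qed

instantiation axes :: (euclidean_space) wellorder
begin

definition "(i::'a axes) \<le> j \<longleftrightarrow> axes_rank i \<le> axes_rank j"
definition "(i::'a axes) < j \<longleftrightarrow> axes_rank i < axes_rank j"

instance
proof
  fix P :: "'a axes \<Rightarrow> bool" and a
  assume *: "\<And>x. (\<And>y. y < x \<Longrightarrow> P y) \<Longrightarrow> P x"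
  show "P a"
  proof (induction a rule: measure_induct_rule[of axes_rank])
    case (less x)
    then show ?case using * unfolding less_axes_def by metis
  qed
next
  fix x y z :: "'a axes"
  show "(x < y) = (x \<le> y \<and> \<not> y \<le> x)" "x \<le> x" "x \<le> y \<or> y \<le> x"
    unfolding less_eq_axes_def less_axes_def by linarith+
  show "x \<le> y \<Longrightarrow> y \<le> z \<Longrightarrow> x \<le> z"
    unfolding less_eq_axes_def by linarith
  show "x \<le> y \<Longrightarrow> y \<le> x \<Longrightarrow> x = y"
    unfolding less_eq_axes_def using injD[OF inj_axes_rank] le_antisym by blast
qed

end

definition of_axes :: "real ^ 'a axes \<Rightarrow> 'a::euclidean_space" where
  "of_axes v = (\<Sum>i\<in>UNIV. (v $ i) *\<^sub>R Rep_axes i)"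

lemma inner_Rep_axes: "Rep_axes i \<bullet> Rep_axes j = (if i = j then 1 else 0)"
  using Rep_axes[of i] Rep_axes[of j] by (simp add: inner_Basis Rep_axes_inject)

lemma of_axes_inner_Rep [simp]: "of_axes v \<bullet> Rep_axes i = v $ i"
  by (simp add: of_axes_def inner_sum_left inner_Rep_axes if_distrib cong: if_cong)

lemma Basis_eq_range_Rep: "Basis = range Rep_axes"
  by (rule type_definition.Rep_range[OF type_definition_axes, symmetric])

lemma of_axes_component: "(\<chi> i. x \<bullet> Rep_axes i) = v \<longleftrightarrow> of_axes v = x"
  unfolding euclidean_eq_iff[of "of_axes v" x] by (auto simp: vec_eq_iff Basis_eq_range_Rep)

lemma linear_of_axes: "linear of_axes"
  by (auto intro!: linearI simp: of_axes_def scaleR_left_distrib sum.distrib scaleR_sum_right)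

lemma inner_of_axes: "of_axes v \<bullet> of_axes w = v \<bullet> w"
  unfolding of_axes_def[of w]
  by (simp add: inner_sum_right inner_vec_def mult.commute)

lemma norm_of_axes: "norm (of_axes v) = norm v"
  by (simp add: norm_eq_sqrt_inner inner_of_axes)

lemma surj_of_axes: "surj of_axes"
proof (rule surjI)
  show "of_axes (\<chi> i. x \<bullet> Rep_axes i) = x" for x
    using of_axes_component by blast
qed

lemma DIM_axes: "CARD('a::euclidean_space axes) = DIM('a)"
  by (simp add: Basis_eq_range_Rep card_image inj_on_def Rep_axes_inject)

lemma borel_measurable_of_axes [measurable]: "of_axes \<in> borel_measurable borel"
  by (intro borel_measurable_continuous_onI linear_continuous_on linear_conv_bounded_linear[THEN iffD1] linear_of_axes)

lemma distr_of_axes_lborel: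
  "distr lborel borel of_axes = (lborel :: 'a::euclidean_space measure)"
proof (rule lborel_eqI[symmetric])
  fix l u :: 'a assume le: "\<And>b. b \<in> Basis \<Longrightarrow> l \<bullet> b \<le> u \<bullet> b"
  let ?J = "\<lambda>x::'a. (\<chi> i. x \<bullet> Rep_axes i)"
  have vec_Basis: "Basis = range (\<lambda>i::'a axes. axis i (1::real))"
    by (auto simp: Basis_vec_def)
  have "of_axes -` box l u = box (?J l) (?J u)"
    by (simp add: set_eq_iff mem_box_cart) (simp add: mem_box Basis_eq_range_Rep[where 'a='a])
  then have "emeasure (distr lborel borel of_axes) (box l u) = emeasure lborel (box (?J l) (?J u))"
    by (simp add: emeasure_distr)
  also have "\<dots> = (\<Prod>b\<in>Basis. (?J u - ?J l) \<bullet> b)"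
    using le by (intro emeasure_lborel_box) (auto simp: vec_Basis inner_axis Basis_eq_range_Rep[where 'a='a])
  also have "(\<Prod>b\<in>Basis. (?J u - ?J l) \<bullet> b) = (\<Prod>i\<in>UNIV. (u - l) \<bullet> Rep_axes i)"
    unfolding vec_Basis
    by (subst prod.reindex) (auto simp: inner_axis inner_diff_left inj_on_def axis_eq_axis)
  also have "\<dots> = (\<Prod>b\<in>Basis. (u - l) \<bullet> b)"
    unfolding Basis_eq_range_Rep by (subst prod.reindex) (auto simp: inj_on_def Rep_axes_inject)
  finally show "emeasure (distr lborel borel of_axes) (box l u) = (\<Prod>b\<in>Basis. (u - l) \<bullet> b)" .
qed simp

section \<open>The Poisson kernel has mean one\<close>

lemma borel_measurable_sphere_stretch [measurable]: "sphere_stretch p \<in> borel_measurable borel"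
  unfolding sphere_stretch_def[abs_def] by measurable

lemma of_axes_eq_0_iff: "of_axes v = 0 \<longleftrightarrow> v = 0"
  by (metis norm_of_axes norm_eq_zero)

lemma stretch_power_nn_integral:
  fixes p :: "'a::euclidean_space"
  shows "(\<integral>\<^sup>+ y. ennreal (1 / sphere_stretch p y ^ (DIM('a) - 1)) * indicator (ball 0 1 - {0}) y \<partial>lborel)
    = emeasure lborel (ball 0 1 :: 'a set)"
proof -
  obtain q where q: "p = of_axes q" using surj_of_axes by (metis surjD)
  have stretch: "sphere_stretch p (of_axes y) = sphere_stretch q y" for y
    by (simp add: sphere_stretch_def boost_cosh_def q inner_of_axes norm_of_axes)
  have ind: "indicator (ball 0 1 - {0 :: 'a}) (of_axes v) = (indicator (ball 0 1 - {0}) v :: ennreal)" for v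
    using norm_of_axes[of v] of_axes_eq_0_iff[of v] by (auto simp: indicator_def)
  have ind2: "indicator (ball 0 1 :: 'a set) (of_axes v) = (indicator (ball 0 1) v :: ennreal)" for v
    using norm_of_axes[of v] by (auto simp: indicator_def)
  have meas: "(\<lambda>y. ennreal (1 / sphere_stretch p y ^ (DIM('a) - Suc 0)) * indicator (ball 0 1 - {0}) y) \<in> borel_measurable borel"
  proof (intro borel_measurable_times_ennreal borel_measurable_indicator)
    show "(\<lambda>y. ennreal (1 / sphere_stretch p y ^ (DIM('a) - Suc 0))) \<in> borel_measurable borel"
      by measurable
  qed simp
  have "(\<integral>\<^sup>+ y. ennreal (1 / sphere_stretch p y ^ (DIM('a) - 1)) * indicator (ball 0 1 - {0}) y \<partial>lborel)
      = (\<integral>\<^sup>+ y. ennreal (1 / sphere_stretch p y ^ (DIM('a) - 1)) * indicator (ball 0 1 - {0}) y \<partial>distr lborel borel of_axes)"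
    by (simp add: distr_of_axes_lborel)
  also have "\<dots> = (\<integral>\<^sup>+ v. ennreal (1 / sphere_stretch q v ^ (CARD('a axes) - 1)) * indicator (ball 0 1 - {0}) v \<partial>lborel)"
    by (subst nn_integral_distr) (simp_all add: stretch ind DIM_axes meas)
  also have "\<dots> = ennreal (measure lebesgue (ball 0 1 :: (real ^ 'a axes) set))"
    by (rule nn_integral_has_integral_lebesgue'[OF _ stretch_power_has_integral_vec])
       (use sphere_stretch_pos[of _ q] in \<open>auto simp: less_imp_le\<close>)
  also have "\<dots> = emeasure lborel (ball 0 1 :: (real ^ 'a axes) set)"
    using emeasure_eq_ennreal_measure[of lborel "ball 0 1 :: (real ^ 'a axes) set"]
      emeasure_lborel_ball_finite[of "0 :: real ^ 'a axes" 1]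
    by (simp add: less_top[symmetric])
  also have "\<dots> = (\<integral>\<^sup>+ v. indicator (ball 0 1 :: 'a set) (of_axes v) \<partial>lborel)"
    by (simp add: ind2)
  also have "\<dots> = (\<integral>\<^sup>+ v. indicator (ball 0 1 :: 'a set) v \<partial>distr lborel borel of_axes)"
    by (subst nn_integral_distr) (auto intro: borel_measurable_indicator)
  also have "\<dots> = emeasure lborel (ball 0 1 :: 'a set)"
    by (simp add: distr_of_axes_lborel)
  finally show ?thesis .
qed

lemma borel_measurable_radial [measurable]:
  "(\<lambda>x::'a::euclidean_space. x /\<^sub>R norm x) \<in> borel_measurable borel"
  by measurable

lemma measurable_radial_sphere:
  "(\<lambda>x::'a::euclidean_space. x /\<^sub>R norm x) \<in> restrict_space lborel (ball 0 1 - {0}) \<rightarrow>\<^sub>M restrict_space borel (sphere 0 1)"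
  by (rule measurable_restrict_space2)
     (auto simp: space_restrict_space intro!: measurable_restrict_space1)

lemma unit_sphere_measure_eq:
  "unit_sphere_measure = completion (scale_measure (real DIM('a))
     (distr (restrict_space lborel (ball 0 1 - {0})) (restrict_space borel (sphere 0 1))
        (\<lambda>x::'a::euclidean_space. x /\<^sub>R norm x)))"
  by (simp add: sphere_measure_def divide_inverse)

text \<open>
  The surface measure is the image of the volume under radial projection, up to a factor.
\<close>

lemma nn_integral_unit_sphere:
  fixes f :: "'a::euclidean_space \<Rightarrow> ennreal"
  assumes [measurable]: "f \<in> borel_measurable borel"
  shows "(\<integral>\<^sup>+ y. f y \<partial>unit_sphere_measure)
    = ennreal (real DIM('a)) * (\<integral>\<^sup>+ x. f (x /\<^sub>R norm x) * indicator (ball 0 1 - {0}) x \<partial>lborel)"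
proof -
  have f: "f \<in> borel_measurable (restrict_space borel (sphere 0 1))"
    by (intro measurable_restrict_space1) measurable
  show ?thesis
    unfolding unit_sphere_measure_eq nn_integral_completion
    using f
    by (subst nn_integral_scale_measure)
       (simp_all add: nn_integral_distr[OF measurable_radial_sphere] nn_integral_restrict_space)
qed

text \<open>
  The vector \<open>p = - 2 x / (1 - |x|\<^sup>2)\<close> corresponds to the point of the unit hyperboloid
  above \<open>- x\<close>, in the usual identification of the ball with the hyperboloid.
\<close>

lemma sphere_stretch_eq_poisson:
  fixes x w :: "'a::euclidean_space"
  assumes x: "norm x < 1" and w: "norm w = 1"
  shows "sphere_stretch ((- 2 / (1 - (norm x)\<^sup>2)) *\<^sub>R x) w = (norm (w - x))\<^sup>2 / (1 - (norm x)\<^sup>2)"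
proof -
  define A where "A = 1 - (norm x)\<^sup>2"
  have A: "A > 0" using x by (simp add: A_def abs_square_less_1)
  have n2: "(norm x)\<^sup>2 = 1 - A" by (simp add: A_def)
  have "boost_cosh ((- 2 / A) *\<^sub>R x) = sqrt (((2 - A) / A)\<^sup>2)"
  proof -
    have "1 + (norm ((- 2 / A) *\<^sub>R x))\<^sup>2 = 1 + 4 * (norm x)\<^sup>2 / A\<^sup>2"
      using A by (simp add: power_mult_distrib power_divide)
    also have "\<dots> = ((2 - A) / A)\<^sup>2"
      unfolding n2 using A by (simp add: field_simps power2_eq_square)
    finally show ?thesis by (simp add: boost_cosh_def)
  qed
  also have "\<dots> = (2 - A) / A"
  proof -
    have "A \<le> 1" by (simp add: A_def)
    with A have "(2 - A) / A \<ge> 0" by simp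
    then show ?thesis by (rule real_sqrt_abs[THEN trans, OF abs_of_nonneg])
  qed
  also have "\<dots> = (1 + (norm x)\<^sup>2) / A"
    by (simp add: n2)
  finally have c: "boost_cosh ((2 / A) *\<^sub>R x) = (1 + (norm x)\<^sup>2) / A" by simp
  have "(norm (w - x))\<^sup>2 = 1 + (norm x)\<^sup>2 - 2 * (x \<bullet> w)"
    using w by (simp add: power2_norm_eq_inner inner_diff_left inner_diff_right inner_commute norm_eq_1)
  then show ?thesis
    by (simp add: sphere_stretch_def c A_def[symmetric] w diff_divide_distrib add_divide_distrib)
qed

lemma poisson_nn_integral:
  fixes x :: "'a::euclidean_space"
  assumes x: "norm x < 1"
  shows "(\<integral>\<^sup>+ y. ennreal (((1 - (norm x)\<^sup>2) / (norm (y - x))\<^sup>2) ^ (DIM('a) - 1)) \<partial>unit_sphere_measure)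
    = emeasure unit_sphere_measure (sphere 0 1 :: 'a set)"
proof -
  let ?p = "(- 2 / (1 - (norm x)\<^sup>2)) *\<^sub>R x"
  have "(\<integral>\<^sup>+ y. ennreal (((1 - (norm x)\<^sup>2) / (norm (y - x))\<^sup>2) ^ (DIM('a) - 1)) \<partial>unit_sphere_measure)
      = ennreal (real DIM('a)) * (\<integral>\<^sup>+ y. ennreal (((1 - (norm x)\<^sup>2) / (norm (y /\<^sub>R norm y - x))\<^sup>2) ^ (DIM('a) - 1))
          * indicator (ball 0 1 - {0}) y \<partial>lborel)"
    by (rule nn_integral_unit_sphere) measurable
  also have "(\<integral>\<^sup>+ y. ennreal (((1 - (norm x)\<^sup>2) / (norm (y /\<^sub>R norm y - x))\<^sup>2) ^ (DIM('a) - 1))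
          * indicator (ball 0 1 - {0}) y \<partial>lborel)
      = (\<integral>\<^sup>+ y. ennreal (1 / sphere_stretch ?p y ^ (DIM('a) - 1)) * indicator (ball 0 1 - {0}) y \<partial>lborel)"
  proof (intro nn_integral_cong)
    fix y :: 'a
    have "((1 - (norm x)\<^sup>2) / (norm (y /\<^sub>R norm y - x))\<^sup>2) ^ (DIM('a) - 1) = 1 / sphere_stretch ?p y ^ (DIM('a) - 1)"
      if "y \<noteq> 0"
    proof -
      have "sphere_stretch ?p y = (norm (y /\<^sub>R norm y - x))\<^sup>2 / (1 - (norm x)\<^sup>2)"
        using sphere_stretch_eq_poisson[OF x, of "y /\<^sub>R norm y"]
          sphere_stretch_scaleR[of "inverse (norm y)" ?p y] that by simp
      then show ?thesis
        by (simp only: power_divide) simp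
    qed
    then show "ennreal (((1 - (norm x)\<^sup>2) / (norm (y /\<^sub>R norm y - x))\<^sup>2) ^ (DIM('a) - 1)) * indicator (ball 0 1 - {0}) y
       = ennreal (1 / sphere_stretch ?p y ^ (DIM('a) - 1)) * indicator (ball 0 1 - {0}) y"
      by (cases "y = 0") simp_all
  qed
  also have "\<dots> = emeasure lborel (ball 0 1 :: 'a set)"
    by (rule stretch_power_nn_integral)
  also have "ennreal (real DIM('a)) * emeasure lborel (ball 0 1 :: 'a set) = emeasure unit_sphere_measure (sphere 0 1 :: 'a set)"
    using emeasure_sphere_measure[of 1 "0::'a"] by (simp add: emeasure_ball ennreal_mult)
  finally show ?thesis .
qed

section \<open>Measures of spherical caps\<close>

lemma sets_unit_sphere_measure:
  assumes "A \<in> sets borel" shows "A \<inter> sphere 0 1 \<in> sets (unit_sphere_measure :: 'a::euclidean_space measure)"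
  unfolding sphere_measure_def
  using assms by (intro sets_completionI_sets) (auto simp: sets_restrict_space)

lemma measurable_ident_sphere [measurable]:
  "(\<lambda>x. x) \<in> sphere_measure c R \<rightarrow>\<^sub>M (borel :: 'a::euclidean_space measure)"
  unfolding sphere_measure_def
  by (intro measurable_completion measurableI) (auto simp: space_scale_measure space_restrict_space sets_restrict_space)

lemma emeasure_unit_sphere_finite: "emeasure unit_sphere_measure (sphere 0 1 :: 'a::euclidean_space set) < \<infinity>"
  by (simp add: emeasure_sphere_measure)

lemma measure_unit_sphere_pos: "measure unit_sphere_measure (sphere 0 1 :: 'a::euclidean_space set) > 0"
  by (simp add: measure_def emeasure_sphere_measure)

lemma finite_measure_unit_sphere: "finite_measure (unit_sphere_measure :: 'a::euclidean_space measure)"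
  using emeasure_unit_sphere_finite[where 'a='a] by (intro finite_measureI) (auto simp: space_sphere_measure)

abbreviation sphere_area :: "'a::euclidean_space itself \<Rightarrow> real" where
  "sphere_area _ \<equiv> measure unit_sphere_measure (sphere 0 1 :: 'a set)"

text \<open>
  The kernel of the hyperharmonic extension, without the division by the area of the sphere.
\<close>

definition poisson_kernel :: "'a::euclidean_space \<Rightarrow> 'a \<Rightarrow> real" where
  "poisson_kernel x y = ((1 - (norm x)\<^sup>2) / (norm (y - x))\<^sup>2) ^ (DIM('a) - 1)"

lemma borel_measurable_poisson_kernel [measurable]:
  "poisson_kernel x \<in> borel_measurable borel"
  unfolding poisson_kernel_def[abs_def] by measurable

lemma poisson_kernel_nonneg: "norm x < 1 \<Longrightarrow> poisson_kernel x y \<ge> 0"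
  by (simp add: poisson_kernel_def abs_square_le_1)

lemma nn_integral_poisson_kernel:
  assumes x: "norm (x::'a::euclidean_space) < 1"
  shows "(\<integral>\<^sup>+ y. ennreal (poisson_kernel x y) \<partial>unit_sphere_measure)
    = ennreal (sphere_area TYPE('a))"
  using poisson_nn_integral[OF x] emeasure_unit_sphere_finite[where 'a='a]
  by (simp add: poisson_kernel_def emeasure_eq_ennreal_measure)

text \<open>
  The cap is cut out by a ball around a point \<open>x\<close> inside the unit ball, rather than around a
  point of the sphere. It is empty unless \<open>s\<close> exceeds the height \<open>1 - |x|\<close>.
\<close>

definition sphere_cap :: "'a::euclidean_space \<Rightarrow> real \<Rightarrow> 'a set" where
  "sphere_cap x s = {y \<in> sphere 0 1. norm (y - x) < s}"

lemma sphere_cap_sets [measurable]: "sphere_cap x s \<in> sets unit_sphere_measure"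
proof -
  have "sphere_cap x s = ball x s \<inter> sphere 0 1"
    by (auto simp: sphere_cap_def dist_norm norm_minus_commute)
  then show ?thesis using sets_unit_sphere_measure[of "ball x s"] by simp
qed

lemma sphere_cap_subset: "sphere_cap x s \<subseteq> sphere 0 1"
  by (auto simp: sphere_cap_def)

lemma measure_sphere_cap_le_total:
  "measure unit_sphere_measure (sphere_cap x s) \<le> sphere_area TYPE('a)"
  for x :: "'a::euclidean_space"
proof (rule finite_measure.finite_measure_mono[OF finite_measure_unit_sphere sphere_cap_subset])
  show "(sphere 0 1 :: 'a set) \<in> sets unit_sphere_measure"
    using sets_unit_sphere_measure[of UNIV] by simp
qed

lemma one_minus_norm_square_bounds:
  assumes "norm x \<le> 1" shows "1 - norm x \<le> 1 - (norm x)\<^sup>2" "1 - (norm x)\<^sup>2 \<le> 2 * (1 - norm x)"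
proof -
  have e: "1 - (norm x)\<^sup>2 = (1 - norm x) * (1 + norm x)" by (simp add: power2_eq_square algebra_simps)
  show "1 - norm x \<le> 1 - (norm x)\<^sup>2" "1 - (norm x)\<^sup>2 \<le> 2 * (1 - norm x)"
    unfolding e using assms mult_left_mono[of 1 "1 + norm x" "1 - norm x"]
      mult_left_mono[of "1 + norm x" 2 "1 - norm x"] by auto
qed

lemma norm_diff_sphere_ge: "norm y = 1 \<Longrightarrow> 1 - norm x \<le> norm (y - x)"
  by (metis norm_triangle_ineq2)

lemma poisson_kernel_ge:
  fixes x y :: "'a::euclidean_space"
  assumes "norm x < 1" "norm y = 1" "norm (y - x) \<le> r" "h \<le> 1 - norm x" "h > 0"
  shows "(h / r\<^sup>2) ^ (DIM('a) - 1) \<le> poisson_kernel x y"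
proof -
  have "norm (y - x) > 0" using assms by auto
  then show ?thesis
    unfolding poisson_kernel_def using assms one_minus_norm_square_bounds[of x]
    by (intro power_mono frac_le power_mono) auto
qed

lemma poisson_kernel_le:
  fixes x y :: "'a::euclidean_space"
  assumes "norm x < 1" "r \<le> norm (y - x)" "r > 0" "1 - norm x \<le> h"
  shows "poisson_kernel x y \<le> (2 * h / r\<^sup>2) ^ (DIM('a) - 1)"
  unfolding poisson_kernel_def using assms one_minus_norm_square_bounds[of x]
  by (intro power_mono frac_le) (auto intro!: power_mono divide_nonneg_nonneg)

lemma move_towards_center:
  fixes x :: "'a::euclidean_space"
  assumes "norm x < 1" "1 - norm x \<le> s" "s < 1"
  obtains x' where "norm x' = 1 - s" "norm (x - x') = s - (1 - norm x)"
proof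
  have x: "norm x > 0" using assms by linarith
  show "norm (((1 - s) / norm x) *\<^sub>R x) = 1 - s"
    using assms x by simp
  have "x - ((1 - s) / norm x) *\<^sub>R x = ((norm x - (1 - s)) / norm x) *\<^sub>R x"
    using x by (simp add: diff_divide_distrib scaleR_diff_left)
  then show "norm (x - ((1 - s) / norm x) *\<^sub>R x) = s - (1 - norm x)"
    using assms x by simp
qed

text \<open>
  At a point of height \<open>s\<close> near \<open>x\<close>, the Poisson kernel is of size \<open>s ^ (- n)\<close> on the cap,
  while its integral is the area of the sphere.
\<close>

lemma measure_sphere_cap_le:
  fixes x :: "'a::euclidean_space"
  assumes x: "norm x < 1" and s: "1 - norm x \<le> s"
  shows "measure unit_sphere_measure (sphere_cap x s)
    \<le> sphere_area TYPE('a) * (4 * s) ^ (DIM('a) - 1)"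
proof (cases "s < 1")
  case False
  then have one: "1 \<le> (4 * s) ^ (DIM('a) - 1)" by (intro one_le_power) auto
  show ?thesis
    using mult_left_mono[OF one less_imp_le[OF measure_unit_sphere_pos[where 'a='a]]]
      measure_sphere_cap_le_total[of x s] by simp
next
  case True
  let ?n = "DIM('a) - 1" and ?V = "measure unit_sphere_measure (sphere_cap x s)"
  let ?T = "sphere_area TYPE('a)"
  have spos: "s > 0" using x s by linarith
  obtain x' where x': "norm x' = 1 - s" "norm (x - x') = s - (1 - norm x)"
    using move_towards_center[OF x s True] .
  have low: "(1 / (4 * s)) ^ ?n \<le> poisson_kernel x' y" if "y \<in> sphere_cap x s" for y
  proof -
    have y: "norm y = 1" "norm (y - x) < s" using that by (auto simp: sphere_cap_def)
    have "norm (y - x') \<le> norm (y - x) + norm (x - x')"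
      using norm_triangle_ineq[of "y - x" "x - x'"] by simp
    then have "norm (y - x') \<le> 2 * s" using x' x y by linarith
    from poisson_kernel_ge[OF _ y(1) this, of s]
    have "(s / (2 * s)\<^sup>2) ^ ?n \<le> poisson_kernel x' y" using x' spos by simp
    moreover have "s / (2 * s)\<^sup>2 = 1 / (4 * s)" using spos by (simp add: power2_eq_square)
    ultimately show ?thesis by simp
  qed
  have "ennreal ((1 / (4 * s)) ^ ?n * ?V)
      = (\<integral>\<^sup>+ y. ennreal ((1 / (4 * s)) ^ ?n) * indicator (sphere_cap x s) y \<partial>unit_sphere_measure)"
    using spos finite_measure.emeasure_finite[OF finite_measure_unit_sphere, of "sphere_cap x s"]
    by (simp add: nn_integral_cmult_indicator ennreal_mult emeasure_eq_ennreal_measure)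
  also have "\<dots> \<le> (\<integral>\<^sup>+ y. ennreal (poisson_kernel x' y) \<partial>unit_sphere_measure)"
    using low by (intro nn_integral_mono) (auto simp: indicator_def intro!: ennreal_leI)
  also have "\<dots> = ennreal ?T"
    using x' spos by (intro nn_integral_poisson_kernel) simp
  finally have "(1 / (4 * s)) ^ ?n * ?V \<le> ?T"
    by (simp add: ennreal_le_iff)
  then show ?thesis
    using spos by (simp add: power_one_over field_simps)
qed

text \<open>
  For small \<open>t\<close>, choose points of heights \<open>t\<close> and \<open>16 t\<close> on the ray through \<open>x\<close>. Off the
  cap, the Poisson kernel of the first point is at most half that of the second one. As both
  kernels have the same integral, at least half of the mass of the first kernel lies on the
  cap, where the kernel is at most \<open>(2 / t) ^ n\<close>.
\<close>

lemma measure_sphere_cap_ge: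
  fixes x :: "'a::euclidean_space"
  assumes x: "norm x < 1" and t: "1 - norm x \<le> t" "t \<le> 2" and dim: "DIM('a) \<ge> 2"
  shows "sphere_area TYPE('a) * t ^ (DIM('a) - 1)
    \<le> 2 ^ DIM('a) * measure unit_sphere_measure (sphere_cap x (48 * t))"
proof -
  let ?n = "DIM('a) - 1"
  let ?T = "sphere_area TYPE('a)"
  have tpos: "t > 0" using x t by linarith
  have dimn: "(2::real) ^ DIM('a) = 2 * 2 ^ ?n" by (metis DIM_positive power_minus_mult mult.commute)
  show ?thesis
  proof (cases "t \<le> 1 / 16")
    case False
    \<comment> \<open>All points of the sphere are at distance less than 2 from \<open>x\<close>, and \<open>48 t > 3\<close>.\<close>
    have "sphere_cap x (48 * t) = sphere 0 1"
    proof -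
      have "norm (y - x) < 48 * t" if "norm y = 1" for y
        using norm_triangle_ineq4[of y x] that x False by linarith
      then show ?thesis by (auto simp: sphere_cap_def)
    qed
    moreover have "t ^ ?n \<le> 2 ^ DIM('a)"
    proof -
      have "t ^ ?n \<le> 2 ^ ?n" using t tpos by (intro power_mono) auto
      also have "\<dots> \<le> 2 ^ DIM('a)" by (simp add: power_increasing)
      finally show ?thesis .
    qed
    ultimately show ?thesis
      by (simp add: mult.commute mult_right_mono)
  next
    case True
    define V where "V = measure unit_sphere_measure (sphere_cap x (48 * t))"
    obtain x' where x': "norm x' = 1 - t" "norm (x - x') = t - (1 - norm x)"
      using move_towards_center[OF x t(1)] True by auto
    obtain x'' where x'': "norm x'' = 1 - 16 * t" "norm (x' - x'') = 15 * t"
    proof (cases "t = 1 / 16")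
      case True
      then show ?thesis using that[of 0] x' by simp
    next
      case False
      then show ?thesis
        using move_towards_center[of x' "16 * t"] that x' True tpos by auto
    qed
    \<comment> \<open>The cap of size \<open>48 t\<close> around \<open>x\<close> contains the one of size \<open>15 t\<close> around \<open>x'\<close>;
      outside of the latter, \<open>|y - x''| \<le> 2 |y - x'|\<close>.\<close>
    have bound: "poisson_kernel x' y \<le> (2 / t) ^ ?n * indicator (sphere_cap x (48 * t)) y + 1 / 2 * poisson_kernel x'' y"
      if y: "norm y = 1" for y
    proof (cases "norm (y - x') < 15 * t")
      case near: True
      have "norm (y - x) \<le> norm (y - x') + norm (x - x')"
        using norm_triangle_ineq[of "y - x'" "x' - x"] by (simp add: norm_minus_commute)
      then have "y \<in> sphere_cap x (48 * t)"
        using near x' x y tpos by (auto simp: sphere_cap_def)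
      moreover have "poisson_kernel x' y \<le> (2 * t / t\<^sup>2) ^ ?n"
        using norm_diff_sphere_ge[OF y, of x'] x' tpos by (intro poisson_kernel_le) auto
      moreover have "2 * t / t\<^sup>2 = 2 / t" using tpos by (simp add: power2_eq_square)
      moreover have "poisson_kernel x'' y \<ge> 0" using x'' tpos by (intro poisson_kernel_nonneg) simp
      ultimately show ?thesis by simp
    next
      case far: False
      define r where "r = norm (y - x')"
      have r: "r > 0" using far tpos unfolding r_def by linarith
      have "norm (y - x'') \<le> norm (y - x') + norm (x' - x'')"
        using norm_triangle_ineq[of "y - x'" "x' - x''"] by simp
      then have "norm (y - x'') \<le> 2 * r" using far x'' by (simp add: r_def)
      then have "(16 * t / (2 * r)\<^sup>2) ^ ?n \<le> poisson_kernel x'' y"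
        using x'' tpos y by (intro poisson_kernel_ge) auto
      moreover have "poisson_kernel x' y \<le> (2 * t / r\<^sup>2) ^ ?n"
        using r x' tpos by (intro poisson_kernel_le) (auto simp: r_def)
      moreover have "(2 * t / r\<^sup>2) ^ ?n = (1 / 2) ^ ?n * (16 * t / (2 * r)\<^sup>2) ^ ?n"
        unfolding power_mult_distrib[symmetric] by (simp add: power_mult_distrib)
      moreover have "(1 / 2 :: real) ^ ?n \<le> 1 / 2"
        using power_decreasing[of 1 ?n "1 / 2 :: real"] dim by simp
      moreover have "(16 * t / (2 * r)\<^sup>2) ^ ?n \<ge> 0" using tpos by simp
      ultimately have "poisson_kernel x' y \<le> 1 / 2 * poisson_kernel x'' y"
        using mult_mono[of "(1 / 2) ^ ?n" "1 / 2" "(16 * t / (2 * r)\<^sup>2) ^ ?n" "poisson_kernel x'' y"] by linarith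
      moreover have "(2 / t) ^ ?n * indicator (sphere_cap x (48 * t)) y \<ge> 0" using tpos by simp
      ultimately show ?thesis by linarith
    qed
    have "ennreal ?T = (\<integral>\<^sup>+ y. ennreal (poisson_kernel x' y) \<partial>unit_sphere_measure)"
      using x' tpos by (intro nn_integral_poisson_kernel[symmetric]) simp
    also have "\<dots> \<le> (\<integral>\<^sup>+ y. ennreal ((2 / t) ^ ?n) * indicator (sphere_cap x (48 * t)) y
        + ennreal (1 / 2) * ennreal (poisson_kernel x'' y) \<partial>unit_sphere_measure)"
    proof (intro nn_integral_mono)
      fix y :: 'a assume "y \<in> space unit_sphere_measure"
      then have "norm y = 1" by (simp add: space_sphere_measure)
      have half: "ennreal (1 / 2) * ennreal (poisson_kernel x'' y) = ennreal (poisson_kernel x'' y / 2)"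
        by (subst ennreal_mult'[symmetric]) simp_all
      from ennreal_leI[OF bound[OF \<open>norm y = 1\<close>]]
      show "ennreal (poisson_kernel x' y) \<le> ennreal ((2 / t) ^ ?n) * indicator (sphere_cap x (48 * t)) y
        + ennreal (1 / 2) * ennreal (poisson_kernel x'' y)"
        using tpos x'' poisson_kernel_nonneg[of x'' y]
        unfolding half by (simp add: ennreal_plus ennreal_mult' ennreal_indicator)
    qed
    also have "\<dots> = ennreal ((2 / t) ^ ?n) * ennreal V + ennreal (1 / 2) * ennreal ?T"
    proof -
      have "(\<integral>\<^sup>+ y. ennreal (poisson_kernel x'' y) \<partial>unit_sphere_measure) = ennreal ?T"
        using x'' tpos by (intro nn_integral_poisson_kernel) simp
      moreover have "emeasure unit_sphere_measure (sphere_cap x (48 * t)) = ennreal V"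
        using finite_measure.emeasure_finite[OF finite_measure_unit_sphere, of "sphere_cap x (48 * t)"]
        by (simp add: V_def emeasure_eq_ennreal_measure)
      ultimately show ?thesis
        by (subst nn_integral_add) (auto simp: nn_integral_cmult_indicator nn_integral_cmult)
    qed
    also have "\<dots> = ennreal ((2 / t) ^ ?n * V + 1 / 2 * ?T)"
      using tpos measure_nonneg[of unit_sphere_measure]
      by (simp only: ennreal_plus[symmetric] ennreal_mult'[symmetric] V_def)
         (subst ennreal_plus; simp add: ennreal_mult'[symmetric] del: ennreal_half)
    finally have "?T \<le> (2 / t) ^ ?n * V + 1 / 2 * ?T"
      using tpos by (subst (asm) ennreal_le_iff) (simp_all add: V_def)
    moreover have "(2 / t) ^ ?n * V = 2 ^ ?n * V / t ^ ?n" by (simp add: power_divide)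
    ultimately have "?T / 2 \<le> 2 ^ ?n * V / t ^ ?n" by linarith
    then have "?T * t ^ ?n \<le> 2 * (2 ^ ?n * V)"
      using tpos by (simp add: pos_le_divide_eq)
    then show ?thesis by (simp add: dimn V_def)
  qed
qed

section \<open>The triangle inequality of the hyperbolic distance\<close>

lemma cosh_hyp_dist:
  assumes x: "norm x < 1" and y: "norm y < 1"
  shows "cosh (hyp_dist x y)
    = 1 + 2 * (norm (x - y))\<^sup>2 / ((1 - (norm x)\<^sup>2) * (1 - (norm y)\<^sup>2))"
  unfolding hyp_dist_def using x y
  by (intro cosh_arcosh_real) (simp add: abs_square_le_1)

lemma hyp_dist_nonneg:
  assumes x: "norm x < 1" and y: "norm y < 1"
  shows "hyp_dist x y \<ge> 0"
  unfolding hyp_dist_def using x y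
  by (intro arcosh_nonneg_real) (simp add: abs_square_le_1)

lemma hyp_dist_commute: "hyp_dist x y = hyp_dist y x"
  by (simp add: hyp_dist_def norm_minus_commute mult.commute)

text \<open>
  The point \<open>(lift_time x, lift_space x)\<close> of the hyperboloid \<open>c\<^sup>2 = 1 + |p|\<^sup>2\<close> corresponds
  to \<open>x\<close> by stereographic projection.
\<close>

definition lift_time :: "'a::euclidean_space \<Rightarrow> real" where
  "lift_time x = (1 + (norm x)\<^sup>2) / (1 - (norm x)\<^sup>2)"

definition lift_space :: "'a::euclidean_space \<Rightarrow> 'a" where
  "lift_space x = (2 / (1 - (norm x)\<^sup>2)) *\<^sub>R x"

lemma cosh_hyp_dist_eq_minkowski:
  assumes x: "norm x < 1" and y: "norm y < 1"
  shows "cosh (hyp_dist x y) = lift_time x * lift_time y - lift_space x \<bullet> lift_space y"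
proof -
  define A B where "A = 1 - (norm x)\<^sup>2" and "B = 1 - (norm y)\<^sup>2"
  have A: "A > 0" and B: "B > 0" using x y by (auto simp: A_def B_def abs_square_less_1)
  have e: "(norm (x - y))\<^sup>2 = (1 - A) + (1 - B) - 2 * (x \<bullet> y)"
    "lift_time x = (2 - A) / A" "lift_time y = (2 - B) / B"
    "lift_space x \<bullet> lift_space y = 4 * (x \<bullet> y) / (A * B)"
    by (simp_all add: A_def B_def power2_norm_eq_inner inner_diff_left inner_diff_right inner_commute
        lift_time_def lift_space_def)
  show ?thesis
    unfolding cosh_hyp_dist[OF x y] A_def[symmetric] B_def[symmetric] e
    using A B by (simp add: field_simps)
qed

lemma lift_time_square:
  assumes "norm x < 1" shows "(lift_time x)\<^sup>2 = 1 + (norm (lift_space x))\<^sup>2" "lift_time x > 0"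
proof -
  have "cosh (hyp_dist x x) = 1" by (simp add: hyp_dist_def)
  then show "(lift_time x)\<^sup>2 = 1 + (norm (lift_space x))\<^sup>2"
    using cosh_hyp_dist_eq_minkowski[OF assms assms] unfolding power2_norm_eq_inner by (simp add: power2_eq_square)
  show "lift_time x > 0"
    using assms by (auto simp: lift_time_def abs_square_less_1 intro!: divide_pos_pos add_pos_nonneg)
qed

text \<open>
  On the hyperboloid, \<open>cosh\<close> of the distance is the Minkowski product. The auxiliary map \<open>S\<close>
  is the spatial part after the boost that moves \<open>y\<close> to the origin. There the lengths of the
  images of \<open>x\<close> and \<open>z\<close> are \<open>sinh\<close> of their distances to \<open>y\<close>, and the claim becomes the
  Cauchy-Schwarz inequality together with the addition formula for \<open>cosh\<close>.
\<close>

lemma hyp_dist_triangle: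
  fixes x y z :: "'a::euclidean_space"
  assumes x: "norm x < 1" and y: "norm y < 1" and z: "norm z < 1"
  shows "hyp_dist x z \<le> hyp_dist x y + hyp_dist y z"
proof -
  define c where "c = lift_time y"
  define S where "S = (\<lambda>w::'a. lift_space w
     - (lift_time w - (lift_space w \<bullet> lift_space y) / (1 + c)) *\<^sub>R lift_space y)"
  have c: "c > 0" "lift_space y \<bullet> lift_space y = (c - 1) * (1 + c)"
    using lift_time_square[OF y] unfolding power2_norm_eq_inner by (auto simp: c_def power2_eq_square algebra_simps)
  have S: "S v \<bullet> S w = (lift_time v * c - lift_space v \<bullet> lift_space y) * (lift_time w * c - lift_space w \<bullet> lift_space y)
      - (lift_time v * lift_time w - lift_space v \<bullet> lift_space w)" for v w
  proof -
    define a b where "a = (lift_space v \<bullet> lift_space y) / (1 + c)" and "b = (lift_space w \<bullet> lift_space y) / (1 + c)"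
    have ab: "lift_space v \<bullet> lift_space y = a * (1 + c)" "lift_space w \<bullet> lift_space y = b * (1 + c)"
      using c by (auto simp: a_def b_def)
    have S_eq: "S v = lift_space v - (lift_time v - a) *\<^sub>R lift_space y"
      "S w = lift_space w - (lift_time w - b) *\<^sub>R lift_space y"
      by (simp_all add: S_def a_def b_def)
    have "S v \<bullet> S w = lift_space v \<bullet> lift_space w
        - (lift_time w - b) * (lift_space v \<bullet> lift_space y) - (lift_time v - a) * (lift_space w \<bullet> lift_space y)
        + (lift_time v - a) * (lift_time w - b) * (lift_space y \<bullet> lift_space y)"
      unfolding S_eq inner_commute[of "lift_space w" "lift_space y"]
      by (simp add: inner_diff_left inner_diff_right algebra_simps)
    then show ?thesis
      unfolding ab c(2) by (simp add: algebra_simps)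
  qed
  have norm_S: "norm (S w) = sinh (hyp_dist w y)" if w: "norm w < 1" for w
  proof -
    have cosh: "cosh (hyp_dist w y) = lift_time w * c - lift_space w \<bullet> lift_space y"
      using cosh_hyp_dist_eq_minkowski[OF w y] by (simp add: c_def)
    have "(norm (S w))\<^sup>2 = (cosh (hyp_dist w y))\<^sup>2 - 1"
      using lift_time_square[OF w]
      unfolding power2_norm_eq_inner S cosh by (simp add: power2_eq_square)
    also have "\<dots> = (sinh (hyp_dist w y))\<^sup>2"
      by (simp add: cosh_square_eq)
    finally show ?thesis
      using hyp_dist_nonneg[OF w y] by simp
  qed
  have "cosh (hyp_dist x z) = cosh (hyp_dist x y) * cosh (hyp_dist y z) - S x \<bullet> S z"
    using S[of x z] cosh_hyp_dist_eq_minkowski[OF x z] cosh_hyp_dist_eq_minkowski[OF x y]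
      cosh_hyp_dist_eq_minkowski[OF z y] by (simp add: c_def hyp_dist_commute[of y z])
  also have "\<dots> \<le> cosh (hyp_dist x y) * cosh (hyp_dist y z) + norm (S x) * norm (S z)"
    using Cauchy_Schwarz_ineq2[of "S x" "S z"] by linarith
  also have "\<dots> = cosh (hyp_dist x y + hyp_dist y z)"
    by (simp add: norm_S x z cosh_add hyp_dist_commute[of z y])
  finally show ?thesis
    using hyp_dist_nonneg[OF x y] hyp_dist_nonneg[OF y z] hyp_dist_nonneg[OF x z]
    by (simp add: cosh_real_nonneg_le_iff)
qed

lemma hyp_dist_diff_le:
  assumes "norm a < 1" "norm x < 1" "norm p < 1"
  shows "\<bar>hyp_dist a x - hyp_dist a p\<bar> \<le> hyp_dist x p"
  using hyp_dist_triangle[of a x p] hyp_dist_triangle[of a p x] assms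
  by (simp add: hyp_dist_commute[of p x] abs_le_iff)

lemma borel_measurable_hyp_dist [measurable (raw)]:
  fixes f :: "'c \<Rightarrow> 'a::euclidean_space"
  assumes [measurable]: "f \<in> borel_measurable M"
  shows "(\<lambda>w. hyp_dist a (f w)) \<in> borel_measurable M"
  unfolding hyp_dist_def arcosh_def by measurable

section \<open>Chains of averages\<close>

text \<open>
  A substitute for Hoelder's inequality, to be applied pointwise with the same \<open>t\<close>
  everywhere: \<open>a\<close> is at most \<open>t\<close> or at most \<open>a (a / t) ^ n\<close>.
\<close>

lemma power_young:
  fixes a t :: real
  assumes "a \<ge> 0" "t > 0"
  shows "a \<le> (1 / t ^ n) * a ^ (n + 1) + t"
proof (cases "a \<le> t")
  case True
  then show ?thesis using assms by (simp add: add_increasing)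
next
  case False
  then have "a * t ^ n \<le> a * a ^ n" using assms by (intro mult_left_mono power_mono) auto
  then have "a \<le> (1 / t ^ n) * a ^ (n + 1)"
    using assms by (simp add: field_simps)
  then show ?thesis using assms by linarith
qed

text \<open>
  Three independent points with densities \<open>f\<close>, \<open>g\<close>, \<open>h\<close>: the triangle inequality passes from
  the first to the last through the middle one, over which one averages.
\<close>

lemma chain_step:
  fixes N :: "'a \<times> 'a \<Rightarrow> ennreal" and f g h :: "'a \<Rightarrow> ennreal"
  assumes f: "(\<integral>\<^sup>+ z. f z \<partial>M) = 1"
    and [measurable]: "N \<in> borel_measurable (M \<Otimes>\<^sub>M M)"
      "f \<in> borel_measurable M" "g \<in> borel_measurable M" "h \<in> borel_measurable M"
    and M: "sigma_finite_measure M"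
    and prob: "(\<integral>\<^sup>+ w. g w \<partial>M) = 1"
    "(\<integral>\<^sup>+ y. h y \<partial>M) = 1"
    and triangle: "\<And>z y w. N (z, y) \<le> N (z, w) + N (w, y)"
  shows "(\<integral>\<^sup>+ z. \<integral>\<^sup>+ y. f z * h y * N (z, y) \<partial>M \<partial>M)
    \<le> (\<integral>\<^sup>+ z. \<integral>\<^sup>+ w. f z * g w * N (z, w) \<partial>M \<partial>M) + (\<integral>\<^sup>+ w. \<integral>\<^sup>+ y. g w * h y * N (w, y) \<partial>M \<partial>M)"
proof -
  interpret sigma_finite_measure M by (rule M)
  have "(\<integral>\<^sup>+ z. \<integral>\<^sup>+ y. f z * h y * N (z, y) \<partial>M \<partial>M)
      = (\<integral>\<^sup>+ z. \<integral>\<^sup>+ w. \<integral>\<^sup>+ y. f z * g w * h y * N (z, y) \<partial>M \<partial>M \<partial>M)"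
  proof (rule nn_integral_cong)
    fix z assume [measurable]: "z \<in> space M"
    have "(\<integral>\<^sup>+ w. \<integral>\<^sup>+ y. f z * g w * h y * N (z, y) \<partial>M \<partial>M)
        = (\<integral>\<^sup>+ w. g w * (\<integral>\<^sup>+ y. f z * h y * N (z, y) \<partial>M) \<partial>M)"
      by (rule nn_integral_cong) (simp add: nn_integral_cmult[symmetric] mult_ac)
    also have "\<dots> = (\<integral>\<^sup>+ w. g w \<partial>M) * (\<integral>\<^sup>+ y. f z * h y * N (z, y) \<partial>M)"
      by (simp add: nn_integral_multc)
    finally show "(\<integral>\<^sup>+ y. f z * h y * N (z, y) \<partial>M) = (\<integral>\<^sup>+ w. \<integral>\<^sup>+ y. f z * g w * h y * N (z, y) \<partial>M \<partial>M)"
      by (simp add: prob)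
  qed
  also have "\<dots> \<le> (\<integral>\<^sup>+ z. \<integral>\<^sup>+ w. \<integral>\<^sup>+ y. f z * g w * h y * N (z, w) + f z * g w * h y * N (w, y) \<partial>M \<partial>M \<partial>M)"
    by (intro nn_integral_mono) (auto simp: distrib_left[symmetric] intro!: mult_left_mono triangle)
  also have "\<dots> = (\<integral>\<^sup>+ z. \<integral>\<^sup>+ w. \<integral>\<^sup>+ y. f z * g w * h y * N (z, w) \<partial>M \<partial>M \<partial>M)
      + (\<integral>\<^sup>+ z. \<integral>\<^sup>+ w. \<integral>\<^sup>+ y. f z * g w * h y * N (w, y) \<partial>M \<partial>M \<partial>M)"
    by (simp add: nn_integral_add cong: nn_integral_cong)
  also have "(\<integral>\<^sup>+ z. \<integral>\<^sup>+ w. \<integral>\<^sup>+ y. f z * g w * h y * N (z, w) \<partial>M \<partial>M \<partial>M)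
      = (\<integral>\<^sup>+ z. \<integral>\<^sup>+ w. f z * g w * N (z, w) \<partial>M \<partial>M)"
  proof (intro nn_integral_cong)
    fix z w
    have "(\<integral>\<^sup>+ y. f z * g w * h y * N (z, w) \<partial>M) = (\<integral>\<^sup>+ y. (f z * g w * N (z, w)) * h y \<partial>M)"
      by (simp add: mult_ac)
    then show "(\<integral>\<^sup>+ y. f z * g w * h y * N (z, w) \<partial>M) = f z * g w * N (z, w)"
      by (simp add: nn_integral_cmult prob)
  qed
  also have "(\<integral>\<^sup>+ z. \<integral>\<^sup>+ w. \<integral>\<^sup>+ y. f z * g w * h y * N (w, y) \<partial>M \<partial>M \<partial>M)
      = (\<integral>\<^sup>+ w. \<integral>\<^sup>+ y. g w * h y * N (w, y) \<partial>M \<partial>M)"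
  proof -
    have "(\<integral>\<^sup>+ z. \<integral>\<^sup>+ w. \<integral>\<^sup>+ y. f z * g w * h y * N (w, y) \<partial>M \<partial>M \<partial>M)
        = (\<integral>\<^sup>+ z. f z * (\<integral>\<^sup>+ w. \<integral>\<^sup>+ y. g w * h y * N (w, y) \<partial>M \<partial>M) \<partial>M)"
      by (rule nn_integral_cong) (simp add: nn_integral_cmult[symmetric] mult.assoc cong: nn_integral_cong)
    also have "\<dots> = (\<integral>\<^sup>+ z. f z \<partial>M) * (\<integral>\<^sup>+ w. \<integral>\<^sup>+ y. g w * h y * N (w, y) \<partial>M \<partial>M)"
      by (simp add: nn_integral_multc)
    finally show ?thesis by (simp add: f)
  qed
  finally show ?thesis .
qed

text \<open>
  A telescoping bound \<open>a i \<le> d 0 + \<dots> + d i\<close> costs only a factor two after summation with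
  geometric weights. The induction absorbs the shifted sum, which carries a factor one half,
  and so never subtracts quantities that may be infinite.
\<close>

lemma geometric_chain:
  fixes a d :: "nat \<Rightarrow> ennreal"
  assumes "a 0 \<le> d 0" "\<And>i. i < k \<Longrightarrow> a (Suc i) \<le> d (Suc i) + a i"
  shows "(\<Sum>i\<le>k. ennreal ((1/2) ^ i) * a i) \<le> 2 * (\<Sum>i\<le>k. ennreal ((1/2) ^ i) * d i)"
  using assms
proof (induction k)
  case 0
  then show ?case using order_trans[of "a 0" "d 0" "2 * d 0"] by (simp add: mult_2)
next
  case (Suc k)
  let ?A = "\<Sum>i\<le>k. ennreal ((1/2) ^ i) * a i" and ?D = "\<Sum>i\<le>k. ennreal ((1/2) ^ i) * d i"
  let ?q = "\<lambda>i. ennreal ((1/2) ^ i)"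
  have IH: "?A \<le> 2 * ?D" using Suc by simp
  have half: "?q (Suc i) = ennreal (1/2) * ?q i" for i
    by (simp add: ennreal_mult'[symmetric] del: ennreal_half)
  have "(\<Sum>i\<le>Suc k. ?q i * a i) = a 0 + (\<Sum>i\<le>k. ?q (Suc i) * a (Suc i))"
    by (subst sum.atMost_Suc_shift) simp
  also have "\<dots> \<le> d 0 + (\<Sum>i\<le>k. ?q (Suc i) * (d (Suc i) + a i))"
    using Suc.prems by (intro add_mono sum_mono mult_left_mono) auto
  also have "\<dots> = (\<Sum>i\<le>Suc k. ?q i * d i) + ennreal (1/2) * ?A"
  proof -
    have "(\<Sum>i\<le>k. ?q (Suc i) * (d (Suc i) + a i)) = (\<Sum>i\<le>k. ?q (Suc i) * d (Suc i)) + ennreal (1/2) * ?A"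
      by (simp only: distrib_left sum.distrib sum_distrib_left half mult.assoc)
    moreover have "(\<Sum>i\<le>Suc k. ?q i * d i) = d 0 + (\<Sum>i\<le>k. ?q (Suc i) * d (Suc i))"
      by (subst sum.atMost_Suc_shift) simp
    ultimately show ?thesis by (simp only: add.assoc)
  qed
  also have "\<dots> \<le> (\<Sum>i\<le>Suc k. ?q i * d i) + (\<Sum>i\<le>Suc k. ?q i * d i)"
  proof (rule add_left_mono)
    have "ennreal (1/2) * ?A \<le> ennreal (1/2) * (2 * ?D)"
      by (intro mult_left_mono IH) simp
    also have "ennreal (1/2) * (2 * ?D) = ?D"
      by (simp add: mult.assoc[symmetric] ennreal_numeral[symmetric] ennreal_mult'[symmetric] del: ennreal_half ennreal_numeral)
    also have "?D \<le> (\<Sum>i\<le>Suc k. ?q i * d i)" by simp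
    finally show "ennreal (1/2) * ?A \<le> (\<Sum>i\<le>Suc k. ?q i * d i)" .
  qed
  finally show ?case by (simp only: mult_2)
qed

section \<open>Domination of the Poisson kernel by caps\<close>

text \<open>
  The density of the uniform distribution on the cap of size \<open>48\<close> times \<open>2 ^ i (1 - |x|)\<close>.
  The factor \<open>48\<close> is the one for which \<open>measure_sphere_cap_ge\<close> bounds the measure of the cap
  from below.
\<close>

definition cap_density :: "'a::euclidean_space \<Rightarrow> nat \<Rightarrow> 'a \<Rightarrow> real" where
  "cap_density x i y = indicator (sphere_cap x (48 * (2 ^ i * (1 - norm x)))) y
     / measure unit_sphere_measure (sphere_cap x (48 * (2 ^ i * (1 - norm x))))"

lemma borel_measurable_cap_density [measurable]:
  "cap_density x i \<in> borel_measurable unit_sphere_measure"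
  unfolding cap_density_def[abs_def] by measurable

lemma cap_density_nonneg: "cap_density x i y \<ge> 0"
  by (simp add: cap_density_def)

lemma dyadic_height_ge:
  "norm x < 1 \<Longrightarrow> 1 - norm x \<le> 2 ^ i * (1 - norm x)"
  using mult_right_mono[of 1 "2 ^ i" "1 - norm x"] by simp

lemma inverse_measure_cap_le:
  fixes x :: "'a::euclidean_space"
  assumes x: "norm x < 1" and R: "2 ^ i * (1 - norm x) \<le> 2" and dim: "DIM('a) \<ge> 2"
  defines "V \<equiv> measure unit_sphere_measure (sphere_cap x (48 * (2 ^ i * (1 - norm x))))"
  shows "V > 0" "1 / V \<le> 2 ^ DIM('a) / (sphere_area TYPE('a) * (2 ^ i * (1 - norm x)) ^ (DIM('a) - 1))"
proof -
  have *: "sphere_area TYPE('a) * (2 ^ i * (1 - norm x)) ^ (DIM('a) - 1) \<le> 2 ^ DIM('a) * V"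
    unfolding V_def using measure_sphere_cap_ge[OF x dyadic_height_ge[OF x] R dim] .
  have pos: "sphere_area TYPE('a) * (2 ^ i * (1 - norm x)) ^ (DIM('a) - 1) > 0"
    using x measure_unit_sphere_pos[where 'a='a] by simp
  then have "2 ^ DIM('a) * V > 0" using * by linarith
  then show V: "V > 0" by (simp add: zero_less_mult_iff)
  show "1 / V \<le> 2 ^ DIM('a) / (sphere_area TYPE('a) * (2 ^ i * (1 - norm x)) ^ (DIM('a) - 1))"
    using * V pos by (simp add: divide_simps)
qed

lemma cap_density_le:
  fixes x :: "'a::euclidean_space"
  assumes "norm x < 1" "2 ^ i * (1 - norm x) \<le> 2" "DIM('a) \<ge> 2"
  shows "cap_density x i y \<le> 2 ^ DIM('a) / (sphere_area TYPE('a) * (2 ^ i * (1 - norm x)) ^ (DIM('a) - 1))"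
  using inverse_measure_cap_le[OF assms] assms(1) measure_nonneg[of unit_sphere_measure "sphere 0 1 :: 'a set"]
  by (auto simp: cap_density_def indicator_def intro!: divide_nonneg_nonneg mult_nonneg_nonneg)

lemma nn_integral_cap_density:
  fixes x :: "'a::euclidean_space"
  assumes "norm x < 1" "2 ^ i * (1 - norm x) \<le> 2" "DIM('a) \<ge> 2"
  shows "(\<integral>\<^sup>+ y. ennreal (cap_density x i y) \<partial>unit_sphere_measure) = 1"
proof -
  define B where "B = sphere_cap x (48 * (2 ^ i * (1 - norm x)))"
  define V where "V = measure unit_sphere_measure B"
  have V: "V > 0" using inverse_measure_cap_le(1)[OF assms] by (simp add: V_def B_def)
  have "(\<integral>\<^sup>+ y. ennreal (cap_density x i y) \<partial>unit_sphere_measure)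
      = (\<integral>\<^sup>+ y. ennreal (1 / V) * indicator B y \<partial>unit_sphere_measure)"
    by (intro nn_integral_cong) (simp add: cap_density_def B_def V_def indicator_def)
  also have "\<dots> = ennreal (1 / V) * emeasure unit_sphere_measure B"
    by (intro nn_integral_cmult_indicator) (simp add: B_def)
  also have "emeasure unit_sphere_measure B = ennreal V"
    using finite_measure.emeasure_finite[OF finite_measure_unit_sphere, of B]
    by (simp add: V_def emeasure_eq_ennreal_measure)
  also have "ennreal (1 / V) * ennreal V = 1"
    using V by (simp add: ennreal_mult'[symmetric])
  finally show ?thesis .
qed

text \<open>
  The scales end when they reach the size of the sphere: at the scale \<open>k\<close> the cap is the
  whole sphere, while up to \<open>k\<close> the caps have the measure expected from their size.
\<close>

lemma exists_last_scale:
  fixes x :: "'a::euclidean_space"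
  assumes "norm x < 1"
  obtains k where "1 \<le> 2 ^ k * (1 - norm x)" "2 ^ k * (1 - norm x) \<le> 2"
proof -
  define P where "P = (\<lambda>k::nat. 1 \<le> 2 ^ k * (1 - norm x))"
  have "\<exists>k. P k"
    using real_arch_pow[of 2 "1 / (1 - norm x)"] assms by (auto simp: P_def field_simps intro: less_imp_le)
  define k where "k = (LEAST k. P k)"
  have k: "P k" unfolding k_def using \<open>\<exists>k. P k\<close> by (rule LeastI_ex)
  have "2 ^ k * (1 - norm x) \<le> 2"
  proof (cases k)
    case 0
    then show ?thesis using norm_ge_zero[of x] by (simp, linarith)
  next
    case (Suc j)
    then have "\<not> P j" using not_less_Least[of j P] by (simp add: k_def)
    then show ?thesis by (simp add: P_def Suc)
  qed
  with k show ?thesis using that by (simp add: P_def)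
qed

lemma scale_le_last:
  assumes "i \<le> k" "norm x < 1" "2 ^ k * (1 - norm x) \<le> 2"
  shows "2 ^ i * (1 - norm x) \<le> 2"
proof -
  have "2 ^ i * (1 - norm x) \<le> 2 ^ k * (1 - norm x)"
    using assms by (intro mult_right_mono power_increasing) auto
  then show ?thesis using assms by linarith
qed

text \<open>
  If \<open>i\<close> is the first scale whose cap contains \<open>y\<close>, then \<open>|y - x|\<close> is comparable to
  \<open>R = 2 ^ i (1 - |x|)\<close>, and the kernel is of size \<open>(2 ^ (- i) / R) ^ n\<close>, while the cap has
  measure of order \<open>R ^ n\<close>. The decay \<open>2 ^ (- i n)\<close> is weakened to \<open>2 ^ (- i)\<close>, which
  suffices below.
\<close>

lemma poisson_kernel_le_cap_densities:
  fixes x y :: "'a::euclidean_space"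
  assumes x: "norm x < 1" and y: "norm y = 1" and dim: "DIM('a) \<ge> 2"
    and k: "1 \<le> 2 ^ k * (1 - norm x)" "2 ^ k * (1 - norm x) \<le> 2"
  shows "poisson_kernel x y / sphere_area TYPE('a)
    \<le> 384 ^ (DIM('a) - 1) * (\<Sum>i\<le>k. (1/2) ^ i * cap_density x i y)"
proof -
  define \<delta> where "\<delta> = 1 - norm x"
  define R where "R = (\<lambda>i. 2 ^ i * \<delta>)"
  define P where "P = (\<lambda>i. norm (y - x) < 48 * R i)"
  let ?n = "DIM('a) - 1" and ?T = "sphere_area TYPE('a)"
  have \<delta>: "\<delta> > 0" using x by (simp add: \<delta>_def)
  have T: "?T > 0" by (rule measure_unit_sphere_pos)
  have "P k"
    using norm_triangle_ineq4[of y x] x y k by (simp add: P_def R_def \<delta>_def)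
  \<comment> \<open>The last cap is the whole sphere, so that there is a first one that contains \<open>y\<close>.\<close>
  define i where "i = (LEAST i. P i)"
  have i: "P i" "i \<le> k"
    using \<open>P k\<close> unfolding i_def by (auto intro: LeastI Least_le)
  have far: "R i \<le> norm (y - x)"
  proof (cases i)
    case 0
    then show ?thesis using norm_diff_sphere_ge[OF y, of x] by (simp add: R_def \<delta>_def)
  next
    case (Suc j)
    then have "\<not> P j" using not_less_Least[of j P] by (simp add: i_def)
    moreover have "R i = 2 * R j" "R j > 0" using \<delta> by (simp_all add: R_def Suc)
    ultimately show ?thesis by (simp add: P_def)
  qed
  have Ri: "R i > 0" using \<delta> by (simp add: R_def)
  define V where "V = measure unit_sphere_measure (sphere_cap x (48 * R i))"
  have V: "V > 0"
    using inverse_measure_cap_le(1)[OF x scale_le_last[OF i(2) x k(2)] dim] by (simp add: V_def R_def \<delta>_def)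
  have dens: "cap_density x i y = 1 / V"
    using i(1) y by (simp add: cap_density_def V_def R_def \<delta>_def P_def sphere_cap_def)
  have "V \<le> ?T * (4 * (48 * R i)) ^ ?n"
    unfolding V_def
  proof (rule measure_sphere_cap_le[OF x])
    show "1 - norm x \<le> 48 * R i"
      using dyadic_height_ge[OF x, of i] Ri by (simp add: R_def \<delta>_def)
  qed
  have "poisson_kernel x y \<le> (2 * \<delta> / (R i)\<^sup>2) ^ ?n"
    using far Ri x by (intro poisson_kernel_le) (auto simp: \<delta>_def)
  then have "poisson_kernel x y * V \<le> (2 * \<delta> / (R i)\<^sup>2) ^ ?n * (?T * (4 * (48 * R i)) ^ ?n)"
    using V \<open>V \<le> _\<close> Ri \<delta> by (intro mult_mono) auto
  also have "\<dots> = ?T * (384 * (\<delta> / R i)) ^ ?n"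
  proof -
    have "(2 * \<delta> / (R i)\<^sup>2) * (4 * (48 * R i)) = 384 * (\<delta> / R i)"
      using Ri by (simp add: power2_eq_square)
    moreover have "A ^ ?n * (?T * B ^ ?n) = ?T * (A * B) ^ ?n" for A B :: real
      by (simp add: power_mult_distrib)
    ultimately show ?thesis by metis
  qed
  also have "\<dots> = ?T * (384 ^ ?n * ((1/2) ^ i) ^ ?n)"
  proof -
    have "\<delta> / R i = (1/2) ^ i" using \<delta> by (simp add: R_def power_one_over)
    then show ?thesis by (simp only: power_mult_distrib)
  qed
  also have "\<dots> \<le> ?T * (384 ^ ?n * (1/2) ^ i)"
  proof -
    have "((1/2::real) ^ i) ^ ?n \<le> ((1/2) ^ i) ^ 1"
      using dim by (intro power_decreasing) (auto simp: power_le_one)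
    then show ?thesis using T by (intro mult_left_mono) auto
  qed
  finally have "poisson_kernel x y / ?T \<le> 384 ^ ?n * ((1/2) ^ i * cap_density x i y)"
    using T V by (simp add: dens field_simps)
  also have "\<dots> \<le> 384 ^ ?n * (\<Sum>i\<le>k. (1/2) ^ i * cap_density x i y)"
    using i(2) by (intro mult_left_mono member_le_sum) (auto simp: cap_density_nonneg)
  finally show ?thesis .
qed

section \<open>The distance to the image as a sum over scales\<close>

text \<open>
  Pairs in consecutive caps. For \<open>i = 0\<close> the truncated subtraction makes both points range
  over the smallest cap, which is the starting term of the chain.
\<close>

definition chain_weight :: "'a::euclidean_space \<Rightarrow> nat \<Rightarrow> 'a \<Rightarrow> 'a \<Rightarrow> real" where
  "chain_weight x k z y = (\<Sum>i\<le>k. (1/2) ^ i * (cap_density x i z * cap_density x (i - 1) y))"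

lemma chain_weight_nonneg: "chain_weight x k z y \<ge> 0"
  by (auto simp: chain_weight_def cap_density_nonneg intro!: sum_nonneg)

lemma ennreal_chain_weight:
  "ennreal (chain_weight x k z y)
   = (\<Sum>i\<le>k. ennreal ((1/2) ^ i) * (ennreal (cap_density x i z) * ennreal (cap_density x (i - 1) y)))"
  unfolding chain_weight_def
  by (subst sum_ennreal[symmetric]) (auto simp: cap_density_nonneg ennreal_mult intro!: sum.cong)

lemma nn_integral_chain_weight:
  fixes x :: "'a::euclidean_space" and N :: "'a \<times> 'a \<Rightarrow> ennreal"
  assumes [measurable]: "N \<in> borel_measurable (unit_sphere_measure \<Otimes>\<^sub>M unit_sphere_measure)"
  shows "(\<integral>\<^sup>+ z. \<integral>\<^sup>+ y. ennreal (chain_weight x k z y) * N (z, y) \<partial>unit_sphere_measure \<partial>unit_sphere_measure)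
    = (\<Sum>i\<le>k. ennreal ((1/2) ^ i) * (\<integral>\<^sup>+ z. \<integral>\<^sup>+ y. ennreal (cap_density x i z) * ennreal (cap_density x (i - 1) y) * N (z, y)
        \<partial>unit_sphere_measure \<partial>unit_sphere_measure))"
proof -
  interpret finite_measure "unit_sphere_measure :: 'a measure" by (rule finite_measure_unit_sphere)
  have "(\<integral>\<^sup>+ z. \<integral>\<^sup>+ y. ennreal (chain_weight x k z y) * N (z, y) \<partial>unit_sphere_measure \<partial>unit_sphere_measure)
     = (\<integral>\<^sup>+ z. \<integral>\<^sup>+ y. (\<Sum>i\<le>k. ennreal ((1/2) ^ i) * (ennreal (cap_density x i z) * ennreal (cap_density x (i - 1) y) * N (z, y)))
        \<partial>unit_sphere_measure \<partial>unit_sphere_measure)"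
    by (simp only: ennreal_chain_weight sum_distrib_right mult.assoc)
  also have "\<dots> = (\<integral>\<^sup>+ z. (\<Sum>i\<le>k. ennreal ((1/2) ^ i) * (\<integral>\<^sup>+ y. ennreal (cap_density x i z) * ennreal (cap_density x (i - 1) y) * N (z, y)
        \<partial>unit_sphere_measure)) \<partial>unit_sphere_measure)"
    by (rule nn_integral_cong) (simp add: nn_integral_sum nn_integral_cmult)
  also have "\<dots> = (\<Sum>i\<le>k. ennreal ((1/2) ^ i) * (\<integral>\<^sup>+ z. \<integral>\<^sup>+ y. ennreal (cap_density x i z) * ennreal (cap_density x (i - 1) y) * N (z, y)
        \<partial>unit_sphere_measure \<partial>unit_sphere_measure))"
    by (simp add: nn_integral_sum nn_integral_cmult)
  finally show ?thesis .
qed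

lemma nn_integral_chain_weight_le_2:
  fixes x :: "'a::euclidean_space"
  assumes x: "norm x < 1" and k: "2 ^ k * (1 - norm x) \<le> 2" and dim: "DIM('a) \<ge> 2"
  shows "(\<integral>\<^sup>+ z. \<integral>\<^sup>+ y. ennreal (chain_weight x k z y) \<partial>unit_sphere_measure \<partial>unit_sphere_measure) \<le> 2"
proof -
  have int1: "(\<integral>\<^sup>+ y. ennreal (cap_density x i y) \<partial>unit_sphere_measure) = 1" if "i \<le> k" for i
    using nn_integral_cap_density[OF x scale_le_last[OF that x k] dim] .
  have "(\<integral>\<^sup>+ z. \<integral>\<^sup>+ y. ennreal (cap_density x i z) * ennreal (cap_density x (i - 1) y)
        \<partial>unit_sphere_measure \<partial>unit_sphere_measure) = 1" if "i \<le> k" for i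
    using that by (simp add: nn_integral_cmult int1)
  then have "(\<integral>\<^sup>+ z. \<integral>\<^sup>+ y. ennreal (chain_weight x k z y) * 1 \<partial>unit_sphere_measure \<partial>unit_sphere_measure)
      = (\<Sum>i\<le>k. ennreal ((1/2) ^ i) * 1)"
    by (subst nn_integral_chain_weight[where N = "\<lambda>_. 1"]) (auto intro!: sum.cong)
  also have "\<dots> = ennreal (\<Sum>i\<le>k. (1/2) ^ i)"
    by (simp add: sum_ennreal del: ennreal_half)
  also have "(\<Sum>i\<le>k. (1/2::real) ^ i) = 2 - (1/2) ^ k"
    by (induction k) simp_all
  also have "ennreal (2 - (1/2) ^ k) \<le> ennreal 2"
    by (intro ennreal_leI) simp
  finally show ?thesis by simp
qed

text \<open>
  Let \<open>a i\<close> be the mean of \<open>N\<close> with the first point in the \<open>i\<close>-th cap and the second one in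
  the smallest cap. The Poisson average is dominated by the geometric sum of the \<open>a i\<close>, and
  \<open>a (i + 1)\<close> exceeds \<open>a i\<close> by at most the mean over a pair of consecutive caps.
\<close>

lemma poisson_average_le_chain:
  fixes x :: "'a::euclidean_space" and N :: "'a \<times> 'a \<Rightarrow> ennreal"
  assumes x: "norm x < 1" and dim: "DIM('a) \<ge> 2"
    and k: "1 \<le> 2 ^ k * (1 - norm x)" "2 ^ k * (1 - norm x) \<le> 2"
    and [measurable]: "N \<in> borel_measurable (unit_sphere_measure \<Otimes>\<^sub>M unit_sphere_measure)"
    and triangle: "\<And>z y w. N (z, y) \<le> N (z, w) + N (w, y)"
  shows "(\<integral>\<^sup>+ z. \<integral>\<^sup>+ y. ennreal (poisson_kernel x z / sphere_area TYPE('a)) * ennreal (cap_density x 0 y) * N (z, y)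
      \<partial>unit_sphere_measure \<partial>unit_sphere_measure)
    \<le> ennreal (2 * 384 ^ (DIM('a) - 1))
      * (\<integral>\<^sup>+ z. \<integral>\<^sup>+ y. ennreal (chain_weight x k z y) * N (z, y) \<partial>unit_sphere_measure \<partial>unit_sphere_measure)"
proof -
  interpret finite_measure "unit_sphere_measure :: 'a measure" by (rule finite_measure_unit_sphere)
  let ?S = "unit_sphere_measure :: 'a measure" and ?A = "384 ^ (DIM('a) - 1) :: real"
  let ?g = "\<lambda>i y. ennreal (cap_density x i y)"
  define a where "a = (\<lambda>i. \<integral>\<^sup>+ z. \<integral>\<^sup>+ y. ?g i z * ?g 0 y * N (z, y) \<partial>?S \<partial>?S)"
  define d where "d = (\<lambda>i. \<integral>\<^sup>+ z. \<integral>\<^sup>+ y. ?g i z * ?g (i - 1) y * N (z, y) \<partial>?S \<partial>?S)"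
  have int1: "(\<integral>\<^sup>+ y. ?g i y \<partial>?S) = 1" if "i \<le> k" for i
    using nn_integral_cap_density[OF x scale_le_last[OF that x k(2)] dim] .
  have "(\<integral>\<^sup>+ z. \<integral>\<^sup>+ y. ennreal (poisson_kernel x z / sphere_area TYPE('a)) * ?g 0 y * N (z, y) \<partial>?S \<partial>?S)
      \<le> (\<integral>\<^sup>+ z. \<integral>\<^sup>+ y. ennreal ?A * (\<Sum>i\<le>k. ennreal ((1/2) ^ i) * (?g i z * ?g 0 y * N (z, y))) \<partial>?S \<partial>?S)"
  proof (intro nn_integral_mono)
    fix z y assume "z \<in> space ?S"
    then have "norm z = 1" by (simp add: space_sphere_measure)
    from poisson_kernel_le_cap_densities[OF x this dim k]
    have "ennreal (poisson_kernel x z / sphere_area TYPE('a)) \<le> ennreal (?A * (\<Sum>i\<le>k. (1/2) ^ i * cap_density x i z))"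
      by (rule ennreal_leI)
    also have "\<dots> = ennreal ?A * (\<Sum>i\<le>k. ennreal ((1/2) ^ i) * ?g i z)"
      by (subst ennreal_mult)
         (auto intro!: sum_nonneg arg_cong2[where f="(*)"] sum.cong simp: cap_density_nonneg sum_ennreal[symmetric] ennreal_mult)
    finally have "ennreal (poisson_kernel x z / sphere_area TYPE('a)) * (?g 0 y * N (z, y))
        \<le> ennreal ?A * (\<Sum>i\<le>k. ennreal ((1/2) ^ i) * ?g i z) * (?g 0 y * N (z, y))"
      by (rule mult_right_mono) simp
    then show "ennreal (poisson_kernel x z / sphere_area TYPE('a)) * ?g 0 y * N (z, y)
        \<le> ennreal ?A * (\<Sum>i\<le>k. ennreal ((1/2) ^ i) * (?g i z * ?g 0 y * N (z, y)))"
      by (simp only: sum_distrib_right mult.assoc)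
  qed
  also have "\<dots> = (\<integral>\<^sup>+ z. ennreal ?A * (\<Sum>i\<le>k. ennreal ((1/2) ^ i) * (\<integral>\<^sup>+ y. ?g i z * ?g 0 y * N (z, y) \<partial>?S)) \<partial>?S)"
    by (rule nn_integral_cong) (simp add: nn_integral_sum nn_integral_cmult)
  also have "\<dots> = ennreal ?A * (\<Sum>i\<le>k. ennreal ((1/2) ^ i) * a i)"
    unfolding a_def by (simp add: nn_integral_sum nn_integral_cmult)
  also have "\<dots> \<le> ennreal ?A * (2 * (\<Sum>i\<le>k. ennreal ((1/2) ^ i) * d i))"
  proof (intro mult_left_mono geometric_chain)
    show "a 0 \<le> d 0" by (simp add: a_def d_def)
    show "a (Suc i) \<le> d (Suc i) + a i" if "i < k" for i
      using that unfolding a_def d_def diff_Suc_1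
      by (intro chain_step int1 sigma_finite_measure_axioms triangle) simp_all
  qed simp
  also have "(\<Sum>i\<le>k. ennreal ((1/2) ^ i) * d i)
      = (\<integral>\<^sup>+ z. \<integral>\<^sup>+ y. ennreal (chain_weight x k z y) * N (z, y) \<partial>?S \<partial>?S)"
    unfolding d_def by (rule nn_integral_chain_weight[symmetric]) fact
  finally show ?thesis
    by (simp add: ennreal_mult mult_ac)
qed

lemma hyperharmonic_ext_eq_poisson:
  fixes u :: "'a::euclidean_space \<Rightarrow> 'b::euclidean_space"
  assumes dim: "DIM('a) = n + 1"
  shows "hyperharmonic_ext n u x
    = (\<integral> y. (poisson_kernel x y / sphere_area TYPE('a)) *\<^sub>R u y \<partial>unit_sphere_measure)"
proof -
  have "(1 - (norm x)\<^sup>2) ^ n / sphere_area TYPE('a) * (1 / norm (y - x) ^ (2 * n))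
      = poisson_kernel x y / sphere_area TYPE('a)" for y
    by (simp add: poisson_kernel_def dim power_divide power_mult)
  then show ?thesis
    unfolding hyperharmonic_ext_def integral_scaleR_right[symmetric] scaleR_scaleR by simp
qed

lemma integrable_poisson_scaleR:
  fixes u :: "'a::euclidean_space \<Rightarrow> 'b::euclidean_space"
  assumes x: "norm x < 1" and u: "integrable unit_sphere_measure u"
  shows "integrable unit_sphere_measure (\<lambda>y. (poisson_kernel x y / c) *\<^sub>R u y)"
proof (rule Bochner_Integration.integrable_bound)
  let ?K = "(2 * (1 - norm x) / (1 - norm x)\<^sup>2) ^ (DIM('a) - 1)"
  show "integrable unit_sphere_measure (\<lambda>y. (?K / c) *\<^sub>R u y)"
    using u by simp
  have [measurable]: "u \<in> borel_measurable unit_sphere_measure"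
    using u by (rule borel_measurable_integrable)
  show "(\<lambda>y. (poisson_kernel x y / c) *\<^sub>R u y) \<in> borel_measurable unit_sphere_measure"
    by measurable
  have "norm ((poisson_kernel x y / c) *\<^sub>R u y) \<le> norm ((?K / c) *\<^sub>R u y)" if "norm y = 1" for y
  proof -
    have "poisson_kernel x y \<le> ?K"
      using norm_diff_sphere_ge[OF that, of x] x by (intro poisson_kernel_le) auto
    then have "\<bar>poisson_kernel x y\<bar> \<le> \<bar>?K\<bar>"
      using poisson_kernel_nonneg[OF x, of y] by linarith
    then have "\<bar>poisson_kernel x y\<bar> / \<bar>c\<bar> * norm (u y) \<le> \<bar>?K\<bar> / \<bar>c\<bar> * norm (u y)"
      by (intro mult_right_mono divide_right_mono) auto
    then show ?thesis by (simp only: norm_scaleR abs_divide)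
  qed
  then show "AE y in unit_sphere_measure. norm ((poisson_kernel x y / c) *\<^sub>R u y) \<le> norm ((?K / c) *\<^sub>R u y)"
    by (intro AE_I2) (simp add: space_sphere_measure)
qed

text \<open>
  Since the Poisson kernel has mean one, the constant \<open>v\<close> can be taken inside the integral.
\<close>

lemma dist_hyperharmonic_le:
  fixes u :: "'a::euclidean_space \<Rightarrow> 'b::euclidean_space"
  assumes dim: "DIM('a) = n + 1" and x: "norm x < 1" and u: "integrable unit_sphere_measure u"
  shows "ennreal (norm (hyperharmonic_ext n u x - v))
    \<le> (\<integral>\<^sup>+ z. ennreal (poisson_kernel x z / sphere_area TYPE('a)) * ennreal (norm (u z - v)) \<partial>unit_sphere_measure)"
proof -
  let ?S = "unit_sphere_measure :: 'a measure" and ?T = "sphere_area TYPE('a)"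
  interpret finite_measure ?S by (rule finite_measure_unit_sphere)
  have T: "?T > 0" by (rule measure_unit_sphere_pos)
  have int: "integrable ?S (\<lambda>y. (poisson_kernel x y / ?T) *\<^sub>R u y)"
      "integrable ?S (\<lambda>y. (poisson_kernel x y / ?T) *\<^sub>R v)"
    using integrable_poisson_scaleR[OF x u] integrable_poisson_scaleR[OF x, of "\<lambda>_. v"] by auto
  have "(\<integral>\<^sup>+ y. ennreal (poisson_kernel x y / ?T) \<partial>?S) = ennreal (1 / ?T) * (\<integral>\<^sup>+ y. ennreal (poisson_kernel x y) \<partial>?S)"
    using T by (subst nn_integral_cmult[symmetric]) (auto simp: ennreal_mult'[symmetric] intro!: nn_integral_cong)
  also have "\<dots> = 1"
    using T by (simp add: nn_integral_poisson_kernel[OF x] ennreal_mult'[symmetric])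
  finally have "(\<integral> y. poisson_kernel x y / ?T \<partial>?S) = 1"
    using T poisson_kernel_nonneg[OF x] by (subst integral_eq_nn_integral) auto
  moreover have "(\<integral> y. (poisson_kernel x y / ?T) *\<^sub>R v \<partial>?S) = (\<integral> y. poisson_kernel x y / ?T \<partial>?S) *\<^sub>R v"
    using integrable_poisson_scaleR[OF x, of "\<lambda>_. 1 :: real" ?T] by (intro integral_scaleR_left) auto
  ultimately have "hyperharmonic_ext n u x - v = (\<integral> y. (poisson_kernel x y / ?T) *\<^sub>R (u y - v) \<partial>?S)"
    using int by (simp add: hyperharmonic_ext_eq_poisson[OF dim] scaleR_diff_right)
  moreover have "integrable ?S (\<lambda>y. (poisson_kernel x y / ?T) *\<^sub>R (u y - v))"
    using int by (simp add: scaleR_diff_right)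
  ultimately have "ennreal (norm (hyperharmonic_ext n u x - v))
      \<le> (\<integral>\<^sup>+ z. ennreal (norm ((poisson_kernel x z / ?T) *\<^sub>R (u z - v))) \<partial>?S)"
    using integral_norm_bound_ennreal by metis
  also have "\<dots> = (\<integral>\<^sup>+ z. ennreal (poisson_kernel x z / ?T) * ennreal (norm (u z - v)) \<partial>?S)"
    using poisson_kernel_nonneg[OF x] T
    by (intro nn_integral_cong) (simp add: ennreal_mult[symmetric])
  finally show ?thesis .
qed

text \<open>
  The distance to the image is at most the distance to any value \<open>u y\<close>, hence at most the
  mean over \<open>y\<close> in the smallest cap.
\<close>

lemma infdist_hyperharmonic_le_average:
  fixes u :: "'a::euclidean_space \<Rightarrow> 'b::euclidean_space"
  assumes dim: "DIM('a) = n + 1" "n \<ge> 1" and x: "norm x < 1" and u: "integrable unit_sphere_measure u"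
  shows "ennreal (infdist (hyperharmonic_ext n u x) (u ` sphere 0 1))
    \<le> (\<integral>\<^sup>+ z. \<integral>\<^sup>+ y. ennreal (poisson_kernel x z / sphere_area TYPE('a)) * ennreal (cap_density x 0 y)
          * ennreal (norm (u z - u y)) \<partial>unit_sphere_measure \<partial>unit_sphere_measure)"
proof -
  let ?S = "unit_sphere_measure :: 'a measure" and ?T = "sphere_area TYPE('a)"
  let ?D = "infdist (hyperharmonic_ext n u x) (u ` sphere 0 1)"
  interpret pair_sigma_finite ?S ?S
    using finite_measure_unit_sphere[where 'a='a] by (simp add: pair_sigma_finite_def finite_measure_def)
  have [measurable]: "u \<in> borel_measurable ?S"
    using u by (rule borel_measurable_integrable)
  have "ennreal ?D = ennreal ?D * (\<integral>\<^sup>+ y. ennreal (cap_density x 0 y) \<partial>?S)"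
    using nn_integral_cap_density[OF x, of 0] norm_ge_zero[of x] dim by simp
  also have "\<dots> = (\<integral>\<^sup>+ y. ennreal (cap_density x 0 y) * ennreal ?D \<partial>?S)"
    by (simp add: nn_integral_multc mult.commute)
  also have "\<dots> \<le> (\<integral>\<^sup>+ y. ennreal (cap_density x 0 y) *
      (\<integral>\<^sup>+ z. ennreal (poisson_kernel x z / ?T) * ennreal (norm (u z - u y)) \<partial>?S) \<partial>?S)"
  proof (intro nn_integral_mono mult_left_mono)
    fix y assume "y \<in> space ?S"
    then have "u y \<in> u ` sphere 0 1" by (simp add: space_sphere_measure)
    then have "?D \<le> norm (hyperharmonic_ext n u x - u y)"
      using infdist_le[of "u y"] by (simp add: dist_norm)
    then have "ennreal ?D \<le> ennreal (norm (hyperharmonic_ext n u x - u y))"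
      by (rule ennreal_leI)
    also note dist_hyperharmonic_le[OF dim(1) x u]
    finally show "ennreal ?D \<le> (\<integral>\<^sup>+ z. ennreal (poisson_kernel x z / ?T) * ennreal (norm (u z - u y)) \<partial>?S)" .
  qed simp
  also have "\<dots> = (\<integral>\<^sup>+ y. \<integral>\<^sup>+ z. ennreal (poisson_kernel x z / ?T) * ennreal (cap_density x 0 y)
          * ennreal (norm (u z - u y)) \<partial>?S \<partial>?S)"
    by (rule nn_integral_cong) (simp add: nn_integral_cmult[symmetric] mult_ac)
  also have "\<dots> = (\<integral>\<^sup>+ z. \<integral>\<^sup>+ y. ennreal (poisson_kernel x z / ?T) * ennreal (cap_density x 0 y)
          * ennreal (norm (u z - u y)) \<partial>?S \<partial>?S)"
    by (rule Fubini') measurable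
  finally show ?thesis .
qed

lemma infdist_hyperharmonic_le_young:
  fixes u :: "'a::euclidean_space \<Rightarrow> 'b::euclidean_space"
  assumes dim: "DIM('a) = n + 1" "n \<ge> 1" and x: "norm x < 1" and u: "integrable unit_sphere_measure u"
    and k: "1 \<le> 2 ^ k * (1 - norm x)" "2 ^ k * (1 - norm x) \<le> 2" and t: "t > 0"
  shows "ennreal (infdist (hyperharmonic_ext n u x) (u ` sphere 0 1))
    \<le> ennreal (2 * 384 ^ n) * (ennreal (1 / t ^ n)
        * (\<integral>\<^sup>+ z. \<integral>\<^sup>+ y. ennreal (chain_weight x k z y) * ennreal (norm (u z - u y) ^ (n + 1))
              \<partial>unit_sphere_measure \<partial>unit_sphere_measure) + ennreal (2 * t))"
proof -
  let ?S = "unit_sphere_measure :: 'a measure"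
  interpret finite_measure ?S by (rule finite_measure_unit_sphere)
  have dim2: "DIM('a) \<ge> 2" using dim by simp
  have [measurable]: "u \<in> borel_measurable ?S"
    using u by (rule borel_measurable_integrable)
  have W [measurable]: "(\<lambda>p. chain_weight x k (fst p) (snd p)) \<in> borel_measurable (?S \<Otimes>\<^sub>M ?S)"
    unfolding chain_weight_def by measurable
  have W1 [measurable]: "chain_weight x k z \<in> borel_measurable ?S" for z
    unfolding chain_weight_def[abs_def] by measurable
  have triangle: "norm (u z - u y) \<le> norm (u z - u w) + norm (u w - u y)" for z y w
    using norm_triangle_ineq[of "u z - u w" "u w - u y"] by simp
  have "ennreal (infdist (hyperharmonic_ext n u x) (u ` sphere 0 1))
    \<le> (\<integral>\<^sup>+ z. \<integral>\<^sup>+ y. ennreal (poisson_kernel x z / sphere_area TYPE('a)) * ennreal (cap_density x 0 y)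
          * ennreal (norm (u z - u y)) \<partial>?S \<partial>?S)"
    by (rule infdist_hyperharmonic_le_average[OF dim x u])
  also have "\<dots> \<le> ennreal (2 * 384 ^ n) * (\<integral>\<^sup>+ z. \<integral>\<^sup>+ y. ennreal (chain_weight x k z y) * ennreal (norm (u z - u y)) \<partial>?S \<partial>?S)"
    using poisson_average_le_chain[OF x dim2 k, of "\<lambda>(z, y). ennreal (norm (u z - u y))"]
      triangle dim
    by (auto simp: ennreal_plus[symmetric] intro!: ennreal_leI simp del: ennreal_plus)
  also have "(\<integral>\<^sup>+ z. \<integral>\<^sup>+ y. ennreal (chain_weight x k z y) * ennreal (norm (u z - u y)) \<partial>?S \<partial>?S)
    \<le> (\<integral>\<^sup>+ z. \<integral>\<^sup>+ y. ennreal (1 / t ^ n) * (ennreal (chain_weight x k z y) * ennreal (norm (u z - u y) ^ (n + 1)))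
        + ennreal t * ennreal (chain_weight x k z y) \<partial>?S \<partial>?S)"
  proof (intro nn_integral_mono)
    fix z y
    have "ennreal (norm (u z - u y)) \<le> ennreal ((1 / t ^ n) * norm (u z - u y) ^ (n + 1) + t)"
      using t by (intro ennreal_leI power_young) auto
    also have "\<dots> = ennreal (1 / t ^ n) * ennreal (norm (u z - u y) ^ (n + 1)) + ennreal t"
      using t by (subst ennreal_plus) (auto simp: ennreal_mult'[symmetric])
    finally have "ennreal (chain_weight x k z y) * ennreal (norm (u z - u y))
        \<le> ennreal (chain_weight x k z y) * (ennreal (1 / t ^ n) * ennreal (norm (u z - u y) ^ (n + 1)) + ennreal t)"
      by (rule mult_left_mono) simp
    then show "ennreal (chain_weight x k z y) * ennreal (norm (u z - u y))
       \<le> ennreal (1 / t ^ n) * (ennreal (chain_weight x k z y) * ennreal (norm (u z - u y) ^ (n + 1)))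
        + ennreal t * ennreal (chain_weight x k z y)"
      by (simp only: distrib_left mult_ac)
  qed
  also have "\<dots> = ennreal (1 / t ^ n) * (\<integral>\<^sup>+ z. \<integral>\<^sup>+ y. ennreal (chain_weight x k z y) * ennreal (norm (u z - u y) ^ (n + 1)) \<partial>?S \<partial>?S)
        + ennreal t * (\<integral>\<^sup>+ z. \<integral>\<^sup>+ y. ennreal (chain_weight x k z y) \<partial>?S \<partial>?S)"
  proof -
    have "(\<integral>\<^sup>+ z. \<integral>\<^sup>+ y. ennreal (1 / t ^ n) * (ennreal (chain_weight x k z y) * ennreal (norm (u z - u y) ^ (n + 1)))
        + ennreal t * ennreal (chain_weight x k z y) \<partial>?S \<partial>?S)
      = (\<integral>\<^sup>+ z. ennreal (1 / t ^ n) * (\<integral>\<^sup>+ y. ennreal (chain_weight x k z y) * ennreal (norm (u z - u y) ^ (n + 1)) \<partial>?S)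
        + ennreal t * (\<integral>\<^sup>+ y. ennreal (chain_weight x k z y) \<partial>?S) \<partial>?S)"
      by (rule nn_integral_cong) (simp add: nn_integral_add nn_integral_cmult)
    moreover have "(\<lambda>z. \<integral>\<^sup>+ y. ennreal (chain_weight x k z y) \<partial>?S) \<in> borel_measurable ?S"
      "(\<lambda>z. \<integral>\<^sup>+ y. ennreal (chain_weight x k z y) * ennreal (norm (u z - u y) ^ (n + 1)) \<partial>?S) \<in> borel_measurable ?S"
      unfolding chain_weight_def by measurable
    ultimately show ?thesis
      by (simp add: nn_integral_add nn_integral_cmult)
  qed
  also have "\<dots> \<le> ennreal (1 / t ^ n) * (\<integral>\<^sup>+ z. \<integral>\<^sup>+ y. ennreal (chain_weight x k z y) * ennreal (norm (u z - u y) ^ (n + 1)) \<partial>?S \<partial>?S)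
        + ennreal (2 * t)"
  proof (rule add_left_mono)
    have "ennreal t * (\<integral>\<^sup>+ z. \<integral>\<^sup>+ y. ennreal (chain_weight x k z y) \<partial>?S \<partial>?S) \<le> ennreal t * ennreal 2"
      using nn_integral_chain_weight_le_2[OF x k(2) dim2] by (intro mult_left_mono) auto
    also have "\<dots> = ennreal (2 * t)" using t by (simp add: ennreal_mult'[symmetric] mult.commute del: ennreal_numeral)
    finally show "ennreal t * (\<integral>\<^sup>+ z. \<integral>\<^sup>+ y. ennreal (chain_weight x k z y) \<partial>?S \<partial>?S) \<le> ennreal (2 * t)" .
  qed
  finally show ?thesis by (simp add: mult_left_mono)
qed

section \<open>Decay of the weight in the hyperbolic distance\<close>

text \<open>
  A point at height \<open>|z - y| / 4\<close>, thus comparable with the top of the geodesic from \<open>z\<close> to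
  \<open>y\<close>.
\<close>

definition pair_apex :: "'a::euclidean_space \<Rightarrow> 'a \<Rightarrow> 'a" where
  "pair_apex z y = (1 - norm (z - y) / 4) *\<^sub>R z"

lemma borel_measurable_pair_apex [measurable (raw)]:
  fixes f g :: "'c \<Rightarrow> 'a::euclidean_space"
  assumes [measurable]: "f \<in> borel_measurable M" "g \<in> borel_measurable M"
  shows "(\<lambda>w. pair_apex (f w) (g w)) \<in> borel_measurable M"
  unfolding pair_apex_def by measurable

lemma norm_pair_apex:
  assumes "norm z = 1" "norm y = 1"
  shows "norm (pair_apex z y) = 1 - norm (z - y) / 4"
proof -
  have "norm (z - y) \<le> 2" using norm_triangle_ineq4[of z y] assms by simp
  then show ?thesis using assms by (simp add: pair_apex_def)
qed

lemma norm_diff_pair_apex_le: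
  fixes x z y :: "'a::euclidean_space"
  assumes "norm z = 1"
  shows "norm (x - pair_apex z y) \<le> norm (z - x) + norm (z - y) / 4"
proof -
  have "x - pair_apex z y = (x - z) + (norm (z - y) / 4) *\<^sub>R z"
    by (simp add: pair_apex_def scaleR_diff_left)
  then have "norm (x - pair_apex z y) \<le> norm (x - z) + norm ((norm (z - y) / 4) *\<^sub>R z)"
    by (metis norm_triangle_ineq)
  then show ?thesis using assms by (simp add: norm_minus_commute)
qed

text \<open>
  For a cap of size \<open>R\<close> that contains \<open>z\<close> and \<open>y\<close>, the Euclidean distance from \<open>x\<close> to the
  apex is \<open>O(R)\<close>. As the heights are \<open>1 - |x|\<close> and \<open>|z - y| / 4\<close>, the formula for \<open>cosh\<close> of
  the distance gives \<open>exp d(x, p) = O(R\<^sup>2 / ((1 - |x|) |z - y|))\<close>.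
\<close>

lemma height_ratio_le_exp_hyp_dist:
  fixes x z y :: "'a::euclidean_space"
  assumes x: "norm x < 1" and z: "norm z = 1" and y: "norm y = 1" and zy: "z \<noteq> y"
    and R: "1 - norm x \<le> R" "norm (z - x) \<le> 48 * R" "norm (z - y) \<le> 96 * R"
  shows "((1 - norm x) / R) * (norm (z - y) / R) \<le> 289\<^sup>2 * exp (- hyp_dist x (pair_apex z y))"
proof -
  define \<delta> s p d where "\<delta> = 1 - norm x" and "s = norm (z - y)" and "p = pair_apex z y"
    and "d = hyp_dist x p"
  have pos: "\<delta> > 0" "s > 0" "R > 0" using x zy R by (auto simp: \<delta>_def s_def)
  have np: "norm p = 1 - s / 4" using norm_pair_apex[OF z y] by (simp add: p_def s_def)
  have p: "norm p < 1" using np pos by simp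
  have h: "\<delta> \<le> 1 - (norm x)\<^sup>2" "s / 4 \<le> 1 - (norm p)\<^sup>2"
    using one_minus_norm_square_bounds(1)[of x] one_minus_norm_square_bounds(1)[of p] x p np by (auto simp: \<delta>_def)
  have "norm (x - p) \<le> 72 * R"
    using norm_diff_pair_apex_le[OF z, of x y] R by (simp add: p_def s_def)
  then have "2 * (norm (x - p))\<^sup>2 \<le> 2 * (72 * R)\<^sup>2"
    by (intro mult_left_mono power_mono) auto
  then have "2 * (norm (x - p))\<^sup>2 / ((1 - (norm x)\<^sup>2) * (1 - (norm p)\<^sup>2)) \<le> 2 * (72 * R)\<^sup>2 / (\<delta> * (s / 4))"
    using h pos by (intro frac_le mult_mono) auto
  then have "cosh d \<le> 1 + 41472 * (R\<^sup>2 / (\<delta> * s))"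
    unfolding d_def cosh_hyp_dist[OF x p] using pos by (simp add: power_mult_distrib)
  moreover have "exp d \<le> 2 * cosh d"
    by (simp add: cosh_def)
  ultimately have "exp d \<le> 2 + 82944 * (R\<^sup>2 / (\<delta> * s))" by linarith
  moreover have "\<delta> * s \<le> R * (96 * R)"
    using R pos by (intro mult_mono) (auto simp: \<delta>_def s_def)
  then have "1 \<le> 96 * (R\<^sup>2 / (\<delta> * s))"
    using pos by (simp add: field_simps power2_eq_square)
  \<comment> \<open>\<open>2 * 96 + 82944 \<le> 289\<^sup>2\<close>\<close>
  ultimately have "exp d \<le> 289\<^sup>2 * (R\<^sup>2 / (\<delta> * s))" by simp
  then have "exp d * (\<delta> * s / R\<^sup>2) \<le> 289\<^sup>2"
    using pos by (simp add: field_simps)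
  then have "exp (- d) * (exp d * (\<delta> * s / R\<^sup>2)) \<le> exp (- d) * 289\<^sup>2"
    by (intro mult_left_mono) auto
  then have "\<delta> * s / R\<^sup>2 \<le> 289\<^sup>2 * exp (- d)"
    unfolding mult.assoc[symmetric] exp_minus_inverse[of d, unfolded mult.commute[of "exp d"]]
    by (simp add: mult.commute)
  then show ?thesis
    by (simp add: \<delta>_def s_def d_def p_def power2_eq_square)
qed

text \<open>
  With \<open>R = 2 ^ i (1 - |x|)\<close>, \<open>\<alpha> = (1 - |x|) / R = 2 ^ (- i)\<close> and \<open>\<beta> = |z - y| / R\<close>, which
  is bounded, the \<open>i\<close>-th term times \<open>|z - y| ^ (2 n)\<close> is of order \<open>\<alpha> \<beta> ^ (2 n)\<close>. This is at
  most a constant times \<open>sqrt \<alpha> sqrt (\<alpha> \<beta>)\<close>. The second factor is bounded by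
  \<open>exp (- d(x, p) / 2)\<close>, and half of the decay in \<open>\<alpha>\<close> is kept for the summation over \<open>i\<close>.
\<close>

lemma chain_weight_le:
  fixes x z y a :: "'a::euclidean_space"
  assumes a: "norm a < 1" and x: "norm x < 1" and z: "norm z = 1" and y: "norm y = 1" and zy: "z \<noteq> y"
    and k: "2 ^ k * (1 - norm x) \<le> 2" and dim: "DIM('a) = n + 1" "n \<ge> 1"
  shows "chain_weight x k z y
    \<le> (8 ^ (n + 1) / (sphere_area TYPE('a))\<^sup>2 * 96 ^ (2 * n) * 1156)
       * exp (- \<bar>hyp_dist a x - hyp_dist a (pair_apex z y)\<bar> / 2) / norm (z - y) ^ (2 * n)"
proof -
  define \<delta> s d where "\<delta> = 1 - norm x" and "s = norm (z - y)" and "d = hyp_dist x (pair_apex z y)"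
  let ?T = "sphere_area TYPE('a)" and ?Q = "8 ^ (n + 1) / (sphere_area TYPE('a))\<^sup>2"
  have T: "?T > 0" by (rule measure_unit_sphere_pos)
  have pos: "\<delta> > 0" "s > 0" using x zy by (auto simp: \<delta>_def s_def)
  have dim2: "DIM('a) \<ge> 2" using dim by simp
  have summand: "(1/2) ^ i * (cap_density x i z * cap_density x (i - 1) y)
      \<le> ?Q * 96 ^ (2 * n) * 289 * exp (- d / 2) / s ^ (2 * n) * (3/4) ^ i" (is "_ \<le> ?rhs") if i: "i \<le> k" for i
  proof (cases "cap_density x i z = 0 \<or> cap_density x (i - 1) y = 0")
    case True
    then show ?thesis using pos T by auto
  next
    case False
    define R where "R = 2 ^ i * \<delta>"
    define \<alpha> \<beta> where "\<alpha> = \<delta> / R" and "\<beta> = s / R"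
    have R: "R > 0" "R \<ge> \<delta>" using pos x dyadic_height_ge[OF x, of i] by (auto simp: R_def \<delta>_def)
    have prev: "2 ^ (i - 1) * \<delta> \<le> R" "R \<le> 2 * (2 ^ (i - 1) * \<delta>)"
      using pos by (cases i; simp add: R_def)+
    have zx: "norm (z - x) < 48 * R"
      using False by (auto simp: cap_density_def sphere_cap_def R_def \<delta>_def indicator_def split: if_splits)
    have "norm (y - x) < 48 * (2 ^ (i - 1) * \<delta>)"
      using False by (auto simp: cap_density_def sphere_cap_def \<delta>_def indicator_def split: if_splits)
    then have yx: "norm (y - x) < 48 * R" using prev by linarith
    have sR: "s \<le> 96 * R"
      using norm_triangle_ineq4[of "z - x" "y - x"] zx yx by (simp add: s_def)
    have \<alpha>: "\<alpha> = (1/2) ^ i" "\<alpha> > 0" using pos by (simp_all add: \<alpha>_def R_def power_one_over)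
    have \<beta>: "\<beta> > 0" "\<beta> \<le> 96" using pos R sR by (simp_all add: \<beta>_def field_simps)
    have "cap_density x i z \<le> 2 ^ (n + 1) / (?T * R ^ n)"
      using cap_density_le[OF x scale_le_last[OF i x k] dim2, of z] dim by (simp add: R_def \<delta>_def)
    moreover have "cap_density x (i - 1) y \<le> 2 ^ (n + 1) / (?T * (2 ^ (i - 1) * \<delta>) ^ n)"
      using cap_density_le[OF x scale_le_last[of "i - 1" k x] dim2, of y] i x k dim by (simp add: \<delta>_def)
    moreover have "2 ^ (n + 1) / (?T * (2 ^ (i - 1) * \<delta>) ^ n) \<le> 2 ^ (n + 1) / (?T * (R / 2) ^ n)"
      using T R prev pos by (intro divide_left_mono mult_left_mono power_mono mult_pos_pos) auto
    ultimately have "cap_density x i z * cap_density x (i - 1) y \<le> 2 ^ (n + 1) / (?T * R ^ n) * (2 ^ (n + 1) / (?T * (R / 2) ^ n))"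
      using T R by (intro mult_mono) (auto simp: cap_density_nonneg intro: order_trans divide_nonneg_nonneg)
    also have "\<dots> = 2 * 2 * (2 ^ n * 2 ^ n * 2 ^ n) / (?T\<^sup>2 * R ^ (2 * n))"
    proof -
      have "R ^ (2 * n) = R ^ n * R ^ n" by (simp only: mult_2 power_add)
      then show ?thesis by (simp add: power_divide power2_eq_square mult_ac)
    qed
    also have "\<dots> \<le> ?Q / R ^ (2 * n)"
    proof -
      have "(8::real) ^ n = 2 ^ n * 2 ^ n * 2 ^ n" by (simp flip: power_mult_distrib)
      then show ?thesis using T R by (simp add: divide_right_mono)
    qed
    finally have dens: "cap_density x i z * cap_density x (i - 1) y \<le> ?Q / R ^ (2 * n)" .
    \<comment> \<open>The square of 289 is the constant of \<open>height_ratio_le_exp_hyp_dist\<close>.\<close>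
    have "sqrt (\<alpha> * \<beta>) \<le> 289 * exp (- d / 2)"
    proof (rule real_le_lsqrt)
      have "(exp (- d / 2))\<^sup>2 = exp (- d)" by (simp add: exp_double[symmetric])
      then show "\<alpha> * \<beta> \<le> (289 * exp (- d / 2))\<^sup>2"
        using height_ratio_le_exp_hyp_dist[OF x z y zy, of R] R zx sR
        by (simp add: power_mult_distrib \<alpha>_def \<beta>_def \<delta>_def s_def d_def)
    qed simp
    moreover have "sqrt \<alpha> \<le> (3/4) ^ i"
    proof (rule real_le_lsqrt)
      have "(1/2::real) ^ i \<le> (9/16) ^ i" by (intro power_mono) auto
      also have "(9/16::real) ^ i = ((3/4) ^ i)\<^sup>2"
        by (simp add: power2_eq_square flip: power_mult_distrib)
      finally show "\<alpha> \<le> ((3/4) ^ i)\<^sup>2" by (simp add: \<alpha>)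
    qed simp
    moreover have "\<beta> ^ (2 * n) \<le> 96 ^ (2 * n) * sqrt \<beta>"
    proof -
      have "(\<beta> / 96) ^ (2 * n) \<le> (\<beta> / 96) ^ 1"
        using \<beta> dim by (intro power_decreasing) auto
      also have "\<beta> / 96 \<le> sqrt \<beta>"
        by (rule real_le_rsqrt) (use \<beta> in \<open>simp add: power2_eq_square field_simps\<close>)
      finally show ?thesis by (simp add: power_divide field_simps)
    qed
    ultimately have "sqrt \<alpha> * (\<beta> ^ (2 * n) * sqrt \<alpha>) \<le> (3/4) ^ i * (96 ^ (2 * n) * (289 * exp (- d / 2)))"
    proof -
      assume A: "sqrt (\<alpha> * \<beta>) \<le> 289 * exp (- d / 2)" "sqrt \<alpha> \<le> (3/4) ^ i" "\<beta> ^ (2 * n) \<le> 96 ^ (2 * n) * sqrt \<beta>"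
      have "\<beta> ^ (2 * n) * sqrt \<alpha> \<le> 96 ^ (2 * n) * sqrt \<beta> * sqrt \<alpha>"
        using A(3) \<alpha> by (intro mult_right_mono) auto
      also have "\<dots> = 96 ^ (2 * n) * sqrt (\<alpha> * \<beta>)" by (simp add: real_sqrt_mult)
      also have "\<dots> \<le> 96 ^ (2 * n) * (289 * exp (- d / 2))"
        using A(1) by (intro mult_left_mono) auto
      finally have "\<beta> ^ (2 * n) * sqrt \<alpha> \<le> 96 ^ (2 * n) * (289 * exp (- d / 2))" .
      from mult_mono[OF A(2) this] show ?thesis
        using \<alpha> \<beta> by simp
    qed
    moreover have "sqrt \<alpha> * (\<beta> ^ (2 * n) * sqrt \<alpha>) = (sqrt \<alpha> * sqrt \<alpha>) * \<beta> ^ (2 * n)"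
      by (simp only: mult_ac)
    moreover have "sqrt \<alpha> * sqrt \<alpha> = \<alpha>" using \<alpha>(2) by simp
    ultimately have "\<alpha> * \<beta> ^ (2 * n) \<le> 96 ^ (2 * n) * 289 * exp (- d / 2) * (3/4) ^ i"
      by (simp only: mult_ac)
    then have *: "\<alpha> / R ^ (2 * n) \<le> 96 ^ (2 * n) * 289 * exp (- d / 2) * (3/4) ^ i / s ^ (2 * n)"
      using R pos by (simp add: \<beta>_def power_divide field_simps)
    have "(1/2) ^ i * (cap_density x i z * cap_density x (i - 1) y) \<le> \<alpha> * (?Q / R ^ (2 * n))"
      unfolding \<alpha>(1) by (intro mult_left_mono dens) simp
    also have "\<dots> = ?Q * (\<alpha> / R ^ (2 * n))" by simp
    also have "\<dots> \<le> ?Q * (96 ^ (2 * n) * 289 * exp (- d / 2) * (3/4) ^ i / s ^ (2 * n))"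
      using T by (intro mult_left_mono *) simp
    finally show ?thesis by simp
  qed
  \<comment> \<open>The square root of one half is at most three quarters, and \<open>289 * 4 = 1156\<close>.\<close>
  have geom: "(\<Sum>i\<le>k. (3/4::real) ^ i) \<le> 4"
  proof -
    have "(\<Sum>i\<le>k. (3/4::real) ^ i) = 4 - 3 * (3/4) ^ k" by (induction k) simp_all
    then show ?thesis by simp
  qed
  let ?E = "?Q * 96 ^ (2 * n) * 289 * exp (- d / 2) / s ^ (2 * n)"
  have "chain_weight x k z y \<le> (\<Sum>i\<le>k. ?E * (3/4) ^ i)"
    unfolding chain_weight_def by (intro sum_mono summand) simp
  also have "\<dots> = ?E * (\<Sum>i\<le>k. (3/4) ^ i)" by (rule sum_distrib_left[symmetric])
  also have "\<dots> \<le> ?E * 4"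
    using pos by (intro mult_left_mono geom) auto
  also have "\<dots> = (?Q * 96 ^ (2 * n) * 1156) * exp (- d / 2) / s ^ (2 * n)" by simp
  also have "\<dots> \<le> (?Q * 96 ^ (2 * n) * 1156)
       * exp (- \<bar>hyp_dist a x - hyp_dist a (pair_apex z y)\<bar> / 2) / s ^ (2 * n)"
  proof -
    have "norm (pair_apex z y) < 1" using norm_pair_apex[OF z y] pos by (simp add: s_def)
    from hyp_dist_diff_le[OF a x this] show ?thesis
      using pos by (intro divide_right_mono mult_left_mono) (auto simp: d_def)
  qed
  finally show ?thesis by (simp add: s_def)
qed

section \<open>Averaging over hyperbolic spheres\<close>

lemma borel_measurable_hyperharmonic_ext [measurable]:
  fixes u :: "'a::euclidean_space \<Rightarrow> 'b::euclidean_space"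
  assumes [measurable]: "u \<in> borel_measurable unit_sphere_measure"
  shows "hyperharmonic_ext n u \<in> borel_measurable borel"
proof -
  interpret finite_measure "unit_sphere_measure :: 'a measure" by (rule finite_measure_unit_sphere)
  show ?thesis
    unfolding hyperharmonic_ext_def[abs_def] by measurable
qed

text \<open>
  The essential supremum of a function that is not measurable is infinite, so that the
  measurability of \<open>f\<close> is what makes a pointwise bound sufficient.
\<close>

lemma Linfty_hyp_sphere_infdist_le:
  fixes f :: "'a::euclidean_space \<Rightarrow> 'b::euclidean_space"
  assumes [measurable]: "f \<in> borel_measurable borel" and a: "a \<in> ball 0 1" and r: "r > 0"
    and le: "\<And>x. x \<in> ball 0 1 \<Longrightarrow> hyp_dist a x = r \<Longrightarrow> ennreal (infdist (f x) A) \<le> c"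
  shows "Linfty_hyp_sphere a r (\<lambda>x. infdist (f x) A) \<le> c"
  unfolding Linfty_hyp_sphere_def
proof (rule esssup_I)
  have [measurable]: "(\<lambda>y. infdist y A) \<in> borel_measurable borel"
    by (intro borel_measurable_continuous_onI continuous_intros)
  have "(\<lambda>x. ennreal \<bar>infdist (f x) A\<bar>) \<in> borel_measurable (sphere_measure (hyp_sphere_center a r) (hyp_sphere_radius a r))"
    by measurable
  then show "(\<lambda>x. ennreal \<bar>infdist (f x) A\<bar>) \<in> borel_measurable (hyp_sphere_measure a r)"
    by (simp add: hyp_sphere_measure_def)
  show "AE x in hyp_sphere_measure a r. ennreal \<bar>infdist (f x) A\<bar> \<le> c"
  proof (rule AE_I2)
    fix x assume "x \<in> space (hyp_sphere_measure a r)"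
    then have "x \<in> hyp_sphere a r" using space_hyp_sphere_measure[OF a r] by simp
    then show "ennreal \<bar>infdist (f x) A\<bar> \<le> c"
      using le[of x] by (simp add: hyp_sphere_def infdist_nonneg)
  qed
qed

lemma integrable_sobolev_sphere:
  fixes u :: "'a::euclidean_space \<Rightarrow> 'b::euclidean_space"
  assumes "u \<in> sobolev_sphere n"
  shows "integrable unit_sphere_measure u"
proof (rule integrableI_bounded)
  interpret finite_measure "unit_sphere_measure :: 'a measure" by (rule finite_measure_unit_sphere)
  have [measurable]: "u \<in> borel_measurable unit_sphere_measure"
    and Lp: "(\<integral>\<^sup>+ y. ennreal (norm (u y) ^ (n + 1)) \<partial>unit_sphere_measure) < \<infinity>"
    using assms by (auto simp: sobolev_sphere_def)
  show "u \<in> borel_measurable unit_sphere_measure" by measurable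
  have "(\<integral>\<^sup>+ y. ennreal (norm (u y)) \<partial>unit_sphere_measure)
      \<le> (\<integral>\<^sup>+ y. ennreal (norm (u y) ^ (n + 1)) + 1 \<partial>unit_sphere_measure)"
  proof (rule nn_integral_mono)
    fix y
    have "ennreal (norm (u y)) \<le> ennreal (norm (u y) ^ (n + 1) + 1)"
      using power_young[of "norm (u y)" 1 n] by (intro ennreal_leI) simp
    then show "ennreal (norm (u y)) \<le> ennreal (norm (u y) ^ (n + 1)) + 1"
      by (subst (asm) ennreal_plus) auto
  qed
  also have "\<dots> = (\<integral>\<^sup>+ y. ennreal (norm (u y) ^ (n + 1)) \<partial>unit_sphere_measure) + emeasure unit_sphere_measure (space (unit_sphere_measure :: 'a measure))"
    by (subst nn_integral_add) auto
  also have "\<dots> < \<infinity>"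
    using Lp emeasure_finite[of "space unit_sphere_measure"] by (simp add: less_top[symmetric])
  finally show "(\<integral>\<^sup>+ y. ennreal (norm (u y)) \<partial>unit_sphere_measure) < \<infinity>" .
qed

text \<open>
  The pointwise bound by \<open>\<Phi> (d(a, x))\<close> depends on \<open>x\<close> through its distance to \<open>a\<close> only, so
  that it also bounds the supremum over the hyperbolic sphere. Tonelli's theorem then lets
  the integral in \<open>r\<close> act on the exponential alone.
\<close>

lemma averaged_Linfty_le:
  fixes u :: "'a::euclidean_space \<Rightarrow> 'b::euclidean_space"
  assumes dim: "DIM('a) = n + 1" "n \<ge> 1" and u: "u \<in> sobolev_sphere n"
    and \<rho>: "\<rho> > 0" and a: "a \<in> ball 0 1" and t: "t > 0"
  defines "K \<equiv> 8 ^ (n + 1) / (sphere_area TYPE('a))\<^sup>2 * 96 ^ (2 * n) * 1156"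
  shows "ennreal (1 / \<rho>) * (\<integral>\<^sup>+ r \<in> {0<..<\<rho>}.
      Linfty_hyp_sphere a r (\<lambda>x. infdist (hyperharmonic_ext n u x) (u ` sphere 0 1)) \<partial>lborel)
    \<le> ennreal (2 * 384 ^ n) * (ennreal (1 / t ^ n * K * min 1 (4 / \<rho>)) * gagliardo_energy n u + ennreal (2 * t))"
proof -
  let ?S = "unit_sphere_measure :: 'a measure"
  interpret finite_measure ?S by (rule finite_measure_unit_sphere)
  interpret lS: pair_sigma_finite lborel ?S
    by (simp add: pair_sigma_finite_def sigma_finite_measure_axioms sigma_finite_lborel)
  have T: "sphere_area TYPE('a) > 0" by (rule measure_unit_sphere_pos)
  have K: "K \<ge> 0" by (simp add: K_def)
  have [measurable]: "u \<in> borel_measurable ?S" using u by (simp add: sobolev_sphere_def)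
  have int: "integrable ?S u" by (rule integrable_sobolev_sphere[OF u])
  have na: "norm a < 1" using a by simp
  let ?c = "\<lambda>z y. hyp_dist a (pair_apex z y)"
  let ?G = "\<lambda>z y. ennreal (norm (u z - u y) ^ (n + 1) / norm (z - y) ^ (2 * n))"
  let ?e = "\<lambda>r z y. ennreal (exp (- \<bar>r - ?c z y\<bar> / 2))"
  define \<Phi> where "\<Phi> = (\<lambda>r. \<integral>\<^sup>+ z. \<integral>\<^sup>+ y. ?e r z y * ?G z y \<partial>?S \<partial>?S)"
  have E: "gagliardo_energy n u = (\<integral>\<^sup>+ z. \<integral>\<^sup>+ y. ?G z y \<partial>?S \<partial>?S)"
    unfolding gagliardo_energy_def by (simp add: norm_minus_commute)
  have \<Phi>_meas [measurable]: "\<Phi> \<in> borel_measurable lborel"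
    unfolding \<Phi>_def by measurable
  have pointwise: "ennreal (infdist (hyperharmonic_ext n u x) (u ` sphere 0 1))
      \<le> ennreal (2 * 384 ^ n) * (ennreal (1 / t ^ n * K) * \<Phi> (hyp_dist a x) + ennreal (2 * t))"
    if x: "x \<in> ball 0 1" for x
  proof -
    have nx: "norm x < 1" using x by simp
    obtain k where k: "1 \<le> 2 ^ k * (1 - norm x)" "2 ^ k * (1 - norm x) \<le> 2"
      using exists_last_scale[OF nx] .
    have "(\<integral>\<^sup>+ z. \<integral>\<^sup>+ y. ennreal (chain_weight x k z y) * ennreal (norm (u z - u y) ^ (n + 1)) \<partial>?S \<partial>?S)
        \<le> (\<integral>\<^sup>+ z. \<integral>\<^sup>+ y. ennreal K * (?e (hyp_dist a x) z y * ?G z y) \<partial>?S \<partial>?S)"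
    proof (intro nn_integral_mono)
      fix z y assume "z \<in> space ?S" "y \<in> space ?S"
      then have zy: "norm z = 1" "norm y = 1" by (simp_all add: space_sphere_measure)
      show "ennreal (chain_weight x k z y) * ennreal (norm (u z - u y) ^ (n + 1))
        \<le> ennreal K * (?e (hyp_dist a x) z y * ?G z y)"
      proof (cases "z = y")
        case False
        have "chain_weight x k z y * norm (u z - u y) ^ (n + 1)
          \<le> (K * exp (- \<bar>hyp_dist a x - ?c z y\<bar> / 2) / norm (z - y) ^ (2 * n)) * norm (u z - u y) ^ (n + 1)"
          using chain_weight_le[OF na nx zy False k(2) dim]
          by (intro mult_right_mono) (auto simp: K_def)
        also have "\<dots> = K * (exp (- \<bar>hyp_dist a x - ?c z y\<bar> / 2) * (norm (u z - u y) ^ (n + 1) / norm (z - y) ^ (2 * n)))"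
          by simp
        finally show ?thesis
          unfolding ennreal_mult'[OF chain_weight_nonneg, symmetric] ennreal_mult'[OF exp_ge_zero, symmetric]
            ennreal_mult'[OF K, symmetric] by (rule ennreal_leI)
      qed simp
    qed
    also have "\<dots> = ennreal K * \<Phi> (hyp_dist a x)"
      unfolding \<Phi>_def by (simp add: nn_integral_cmult)
    finally have "ennreal (1 / t ^ n) * (\<integral>\<^sup>+ z. \<integral>\<^sup>+ y. ennreal (chain_weight x k z y) * ennreal (norm (u z - u y) ^ (n + 1)) \<partial>?S \<partial>?S)
        \<le> ennreal (1 / t ^ n * K) * \<Phi> (hyp_dist a x)"
      using t K by (subst ennreal_mult) (auto simp: mult.assoc intro: mult_left_mono)
    then have "ennreal (2 * 384 ^ n) * (ennreal (1 / t ^ n) * (\<integral>\<^sup>+ z. \<integral>\<^sup>+ y. ennreal (chain_weight x k z y) * ennreal (norm (u z - u y) ^ (n + 1)) \<partial>?S \<partial>?S) + ennreal (2 * t))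
        \<le> ennreal (2 * 384 ^ n) * (ennreal (1 / t ^ n * K) * \<Phi> (hyp_dist a x) + ennreal (2 * t))"
      by (intro mult_left_mono add_right_mono) auto
    with infdist_hyperharmonic_le_young[OF dim nx int k t] show ?thesis
      by (rule order_trans)
  qed
  have int_\<Phi>: "(\<integral>\<^sup>+ r. \<Phi> r * indicator {0<..<\<rho>} r \<partial>lborel) \<le> ennreal (min \<rho> 4) * gagliardo_energy n u"
  proof -
    have "(\<integral>\<^sup>+ r. \<Phi> r * indicator {0<..<\<rho>} r \<partial>lborel)
        = (\<integral>\<^sup>+ r. \<integral>\<^sup>+ z. \<integral>\<^sup>+ y. ?e r z y * indicator {0<..<\<rho>} r * ?G z y \<partial>?S \<partial>?S \<partial>lborel)"
    proof (rule nn_integral_cong)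
      fix r :: real
      have "(\<integral>\<^sup>+ z. \<integral>\<^sup>+ y. ?e r z y * indicator {0<..<\<rho>} r * ?G z y \<partial>?S \<partial>?S)
          = (\<integral>\<^sup>+ z. \<integral>\<^sup>+ y. indicator {0<..<\<rho>} r * (?e r z y * ?G z y) \<partial>?S \<partial>?S)"
        by (simp only: mult_ac)
      also have "\<dots> = indicator {0<..<\<rho>} r * \<Phi> r"
        unfolding \<Phi>_def by (simp add: nn_integral_cmult)
      finally show "\<Phi> r * indicator {0<..<\<rho>} r
          = (\<integral>\<^sup>+ z. \<integral>\<^sup>+ y. ?e r z y * indicator {0<..<\<rho>} r * ?G z y \<partial>?S \<partial>?S)"
        by (simp only: mult.commute)
    qed
    also have "\<dots> = (\<integral>\<^sup>+ z. \<integral>\<^sup>+ r. \<integral>\<^sup>+ y. ?e r z y * indicator {0<..<\<rho>} r * ?G z y \<partial>?S \<partial>lborel \<partial>?S)"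
      by (rule lS.Fubini'[symmetric]) measurable
    also have "\<dots> = (\<integral>\<^sup>+ z. \<integral>\<^sup>+ y. \<integral>\<^sup>+ r. ?e r z y * indicator {0<..<\<rho>} r * ?G z y \<partial>lborel \<partial>?S \<partial>?S)"
      by (intro nn_integral_cong lS.Fubini'[symmetric]) measurable
    also have "\<dots> = (\<integral>\<^sup>+ z. \<integral>\<^sup>+ y. (\<integral>\<^sup>+ r. ?e r z y * indicator {0<..<\<rho>} r \<partial>lborel) * ?G z y \<partial>?S \<partial>?S)"
      by (intro nn_integral_cong nn_integral_multc borel_measurable_exp_decay_interval)
    also have "\<dots> \<le> (\<integral>\<^sup>+ z. \<integral>\<^sup>+ y. ennreal (min \<rho> 4) * ?G z y \<partial>?S \<partial>?S)"
      by (intro nn_integral_mono mult_right_mono nn_integral_exp_decay_interval \<rho>) auto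
    also have "\<dots> = ennreal (min \<rho> 4) * gagliardo_energy n u"
      unfolding E by (simp add: nn_integral_cmult)
    finally show ?thesis .
  qed
  have "(\<integral>\<^sup>+ r \<in> {0<..<\<rho>}. Linfty_hyp_sphere a r (\<lambda>x. infdist (hyperharmonic_ext n u x) (u ` sphere 0 1)) \<partial>lborel)
     \<le> (\<integral>\<^sup>+ r. ennreal (2 * 384 ^ n) * (ennreal (1 / t ^ n * K) * (\<Phi> r * indicator {0<..<\<rho>} r) + ennreal (2 * t) * indicator {0<..<\<rho>} r) \<partial>lborel)"
  proof (rule nn_integral_mono)
    fix r :: real
    show "Linfty_hyp_sphere a r (\<lambda>x. infdist (hyperharmonic_ext n u x) (u ` sphere 0 1)) * indicator {0<..<\<rho>} r
        \<le> ennreal (2 * 384 ^ n) * (ennreal (1 / t ^ n * K) * (\<Phi> r * indicator {0<..<\<rho>} r) + ennreal (2 * t) * indicator {0<..<\<rho>} r)"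
    proof (cases "r \<in> {0<..<\<rho>}")
      case True
      have "Linfty_hyp_sphere a r (\<lambda>x. infdist (hyperharmonic_ext n u x) (u ` sphere 0 1))
          \<le> ennreal (2 * 384 ^ n) * (ennreal (1 / t ^ n * K) * \<Phi> r + ennreal (2 * t))"
        by (rule Linfty_hyp_sphere_infdist_le) (use True a pointwise in auto)
      then show ?thesis using True by simp
    qed simp
  qed
  also have "\<dots> = ennreal (2 * 384 ^ n) * (ennreal (1 / t ^ n * K) * (\<integral>\<^sup>+ r. \<Phi> r * indicator {0<..<\<rho>} r \<partial>lborel) + ennreal (2 * t) * ennreal \<rho>)"
    using \<rho> by (simp add: nn_integral_cmult nn_integral_add nn_integral_cmult_indicator)
  also have "\<dots> \<le> ennreal (2 * 384 ^ n) * (ennreal (1 / t ^ n * K) * (ennreal (min \<rho> 4) * gagliardo_energy n u) + ennreal (2 * t) * ennreal \<rho>)"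
    by (intro mult_left_mono add_right_mono int_\<Phi>) auto
  finally have "ennreal (1 / \<rho>) * (\<integral>\<^sup>+ r \<in> {0<..<\<rho>}. Linfty_hyp_sphere a r (\<lambda>x. infdist (hyperharmonic_ext n u x) (u ` sphere 0 1)) \<partial>lborel)
      \<le> ennreal (1 / \<rho>) * (ennreal (2 * 384 ^ n) * (ennreal (1 / t ^ n * K) * (ennreal (min \<rho> 4) * gagliardo_energy n u) + ennreal (2 * t) * ennreal \<rho>))"
    by (rule mult_left_mono) simp
  also have "\<dots> = ennreal (2 * 384 ^ n) * ((ennreal (1 / \<rho>) * (ennreal (1 / t ^ n * K) * ennreal (min \<rho> 4))) * gagliardo_energy n u + ennreal (1 / \<rho>) * (ennreal (2 * t) * ennreal \<rho>))"
    by (simp only: distrib_left mult_ac)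
  also have "ennreal (1 / \<rho>) * (ennreal (1 / t ^ n * K) * ennreal (min \<rho> 4)) = ennreal (1 / t ^ n * K * min 1 (4 / \<rho>))"
  proof -
    have nonneg: "0 \<le> 1 / t ^ n * K" "0 \<le> 1 / \<rho>" using t K \<rho> by simp_all
    have "1 / \<rho> * (1 / t ^ n * K * min \<rho> 4) = 1 / t ^ n * K * min 1 (4 / \<rho>)"
      using \<rho> t by (auto simp: min_def field_simps)
    then show ?thesis
      unfolding ennreal_mult'[OF nonneg(1), symmetric] ennreal_mult'[OF nonneg(2), symmetric] by simp
  qed
  also have "ennreal (1 / \<rho>) * (ennreal (2 * t) * ennreal \<rho>) = ennreal (2 * t)"
    using \<rho> t by (simp add: ennreal_mult'[symmetric])
  finally show ?thesis .
qed

theorem proposition4p2: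
  fixes n :: nat
  assumes "n \<ge> 1" and "CARD('m::finite) = n + 1"
  shows "\<exists>C>0. \<forall>u \<in> (sobolev_sphere n :: (real ^ 'm \<Rightarrow> real ^ 'v::finite) set).
    \<forall>\<rho>>0. \<forall>a \<in> ball 0 1.
      ennreal (1 / \<rho>) *
        (\<integral>\<^sup>+ r \<in> {0<..<\<rho>}.
           Linfty_hyp_sphere a r (\<lambda>x. infdist (hyperharmonic_ext n u x) (u ` sphere 0 1)) \<partial>lborel)
      \<le> ennreal (C / (1 + \<rho> powr (1 / real (n + 1)))
           * enn2real (gagliardo_energy n u) powr (1 / real (n + 1)))"
proof -
  have dim: "DIM(real ^ 'm) = n + 1" using assms by simp
  define K where "K = 8 ^ (n + 1) / (sphere_area TYPE(real ^ 'm))\<^sup>2 * 96 ^ (2 * n) * 1156"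
  define A where "A = 2 * 384 ^ n * (K + 2)"
  have K: "K \<ge> 0" by (simp add: K_def)
  have A: "A > 0" using K by (simp add: A_def)
  let ?\<theta> = "1 / real (n + 1)"
  show ?thesis
  proof (intro exI[of _ "8 * A"] conjI ballI allI impI)
    fix u :: "real ^ 'm \<Rightarrow> real ^ 'v" and \<rho> :: real and a :: "real ^ 'm"
    assume u: "u \<in> sobolev_sphere n" and \<rho>: "\<rho> > 0" and a: "a \<in> ball 0 1"
    define L where "L = ennreal (1 / \<rho>) * (\<integral>\<^sup>+ r \<in> {0<..<\<rho>}.
       Linfty_hyp_sphere a r (\<lambda>x. infdist (hyperharmonic_ext n u x) (u ` sphere 0 1)) \<partial>lborel)"
    define e where "e = enn2real (gagliardo_energy n u)"
    define m where "m = min 1 (4 / \<rho>)"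
    have e: "gagliardo_energy n u = ennreal e" "e \<ge> 0"
      using u by (auto simp: e_def sobolev_sphere_def less_top)
    have m: "m > 0" using \<rho> by (simp add: m_def)
    have L_le: "L \<le> ennreal (2 * 384 ^ n * (K * (m * e / t ^ n) + 2 * t))" if t: "t > 0" for t
    proof -
      have "L \<le> ennreal (2 * 384 ^ n) * (ennreal (1 / t ^ n * K * m) * ennreal e + ennreal (2 * t))"
        using averaged_Linfty_le[OF dim assms(1) u \<rho> a t] by (simp only: L_def K_def e m_def)
      also have "\<dots> = ennreal (2 * 384 ^ n * (K * (m * e / t ^ n) + 2 * t))"
      proof -
        have nonneg: "0 \<le> 1 / t ^ n * K * m" "0 \<le> 1 / t ^ n * K * m * e" "0 \<le> 2 * t" "0 \<le> (2 * 384 ^ n :: real)"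
          using t K m e by simp_all
        have "1 / t ^ n * K * m * e = K * (m * e / t ^ n)" by simp
        then show ?thesis
          unfolding ennreal_mult'[OF nonneg(1), symmetric] ennreal_plus[OF nonneg(2,3), symmetric]
            ennreal_mult'[OF nonneg(4), symmetric] by (simp add: mult_ac)
      qed
      finally show ?thesis .
    qed
    show "L \<le> ennreal (8 * A / (1 + \<rho> powr ?\<theta>) * e powr ?\<theta>)"
    proof (cases "e = 0")
      case True
      have small: "L \<le> ennreal s" if s: "s > 0" for s
      proof -
        have "(2 * 384 ^ n * (2 * (s / (4 * 384 ^ n)))) = s" by simp
        then show ?thesis using L_le[of "s / (4 * 384 ^ n)"] s True by simp
      qed
      \<comment> \<open>For zero energy there is no optimal \<open>t\<close>, but every positive \<open>t\<close> is admissible.\<close>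
      have "L \<le> 0" by (rule ennreal_le_epsilon) (simp add: small)
      then show ?thesis by simp
    next
      case False
      \<comment> \<open>This \<open>t\<close> balances the two terms: \<open>m e / t ^ n = t\<close>.\<close>
      define t where "t = (m * e) powr ?\<theta>"
      have t: "t > 0" using m e False by (simp add: t_def)
      have "t ^ (n + 1) = m * e"
        using m e False by (simp add: t_def powr_realpow[symmetric] powr_powr del: of_nat_Suc of_nat_add power_Suc)
      then have "m * e / t ^ n = t" using t by (simp add: field_simps)
      then have "L \<le> ennreal (A * t)"
        using L_le[OF t] by (simp add: A_def algebra_simps)
      also have "A * t \<le> A * (8 / (1 + \<rho> powr ?\<theta>) * e powr ?\<theta>)"
      proof (intro mult_left_mono)
        have \<theta>: "0 < ?\<theta>" "?\<theta> \<le> 1" by auto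
        have "m powr ?\<theta> * (1 + \<rho> powr ?\<theta>) \<le> 8"
        proof (cases "\<rho> \<le> 1")
          case True
          then have "\<rho> powr ?\<theta> \<le> 1" using \<rho> \<theta> by (intro powr_le1) auto
          moreover have "m powr ?\<theta> \<le> 1" using m \<theta> by (intro powr_le1) (auto simp: m_def)
          ultimately have "m powr ?\<theta> * (1 + \<rho> powr ?\<theta>) \<le> 1 * (1 + 1)"
            by (intro mult_mono) auto
          then show ?thesis by simp
        next
          case False
          then have "1 \<le> \<rho> powr ?\<theta>" using \<theta> by (intro ge_one_powr_ge_zero) auto
          then have "m powr ?\<theta> * (1 + \<rho> powr ?\<theta>) \<le> m powr ?\<theta> * (2 * \<rho> powr ?\<theta>)"
            by (intro mult_left_mono) auto
          also have "\<dots> = 2 * (m * \<rho>) powr ?\<theta>"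
            using m \<rho> by (simp add: powr_mult)
          also have "(m * \<rho>) powr ?\<theta> \<le> 4 powr ?\<theta>"
            using m \<rho> \<theta> by (intro powr_mono2) (auto simp: m_def min_def field_simps)
          also have "(4::real) powr ?\<theta> \<le> 4 powr 1"
            using \<theta> by (intro powr_mono) auto
          finally show ?thesis by simp
        qed
        moreover have "1 + \<rho> powr ?\<theta> > 0" by (simp add: add_pos_nonneg)
        ultimately have "m powr ?\<theta> \<le> 8 / (1 + \<rho> powr ?\<theta>)"
          by (simp add: pos_le_divide_eq)
        then have "m powr ?\<theta> * e powr ?\<theta> \<le> 8 / (1 + \<rho> powr ?\<theta>) * e powr ?\<theta>"
          by (rule mult_right_mono) simp
        then show "t \<le> 8 / (1 + \<rho> powr ?\<theta>) * e powr ?\<theta>"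
          using m e by (simp add: t_def powr_mult)
      qed (use A in simp)
      finally show ?thesis by (simp add: ennreal_leI mult_ac)
    qed
  qed (use A in simp)
qed

end
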